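(* Let $K_{I,J}^{\lambda,\rho}(\mathbf{G})$ be a subdirectly irreducible kite. Then $K_{I,J}^{\lambda,\rho}(\mathbf{G})$ is isomorphic to precisely one of: (1) $K_{n,n}^{\lambda,\rho}(\mathbf{G})$, with $\lambda(j)=j$ and $\rho(j)=j+1\ (\mathrm{mod}\ n)$; (2) $K_{\mathbb{Z},\mathbb{Z}}^{\lambda,\rho}(\mathbf{G})$, with $\lambda(j)=j$ and $\rho(j)=j+1$; (3) $K_{\omega,\omega}^{\lambda,\rho}(\mathbf{G})$, with $\lambda(j)=j$ and $\rho(j)=j+1$; (4) $K_{\omega,\omega}^{\lambda,\rho}(\mathbf{G})$, with $\lambda(j)=j+1$ and $\rho(j)=j$; (5) $K_{n+1,n}^{\lambda,\rho}(\mathbf{G})$, with $\lambda(j)=j$ and $\rho(j)=j+1$ (where $n\in\omega$ in (1) and (5)). Moreover, types (1) and (2) consist entirely of pseudo MV-algebras, and the other types contain no pseudo MV-algebras except the two-element Boolean algebra. A kite of type (3) or (4) is good if and only if it is a two-element Boolean algebra. A kite of type (5) is good if and only if $J=\emptyset$.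
   Context: An FL-algebra is an algebra $\langle A;\wedge,\vee,\backslash,/,\cdot,0,1\rangle$ where $\langle A;\wedge,\vee\rangle$ is a lattice, $\langle A;\cdot,1\rangle$ a monoid, $xy\le z\iff y\le x\backslash z\iff x\le z/y$, and $0\in A$. A pseudo BL-algebra is an FL-algebra with $0\le x\le 1$, $x(x\backslash(x\wedge y))=x\wedge y=((x\wedge y)/x)x$, and $x\backslash y\vee y\backslash x=1=y/x\vee x/y$. Put ${\sim}x=x\backslash 0$, ${-}x=0/x$. A pseudo MV-algebra is a pseudo BL-algebra satisfying $x/(y\backslash x)=x\vee y=(x/y)\backslash x$. A pseudo BL-algebra is good if it satisfies ${\sim}{-}x={-}{\sim}x$. Kites. Let $\mathbf{G}$ be an $\ell$-group (written multiplicatively, identity $e$), $G^+=\{g: g\ge e\}$, $G^-=\{g: g\le e\}$. Let $I,J$ be sets with $|J|\le|I|$ and $\lambda,\rho\colon J\to I$ injections. The kite $K_{I,J}^{\lambda,\rho}(\mathbf{G})$ is the algebra $\langle (G^+)^J\uplus(G^-)^I;\vee,\wedge,\cdot,\backslash,/,1,0\rangle$ (disjoint union) whose order is coordinatewise inside $(G^+)^J$ and inside $(G^-)^I$, with every element of $(G^+)^J$ below every element of $(G^-)^I$. Elements of $(G^-)^I$ are written $\langle a_i^{-1}\rangle_{i\in I}$ with $a_i\in G^+$, elements of $(G^+)^J$ as $\langle f_j\rangle_{j\in J}$; $e^{-1}$ denotes $e$ as an element of $G^-$. $1$ is the constant sequence $e^{-1}$ in $(G^-)^I$ and $0$ the constant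 sequence $e$ in $(G^+)^J$. Multiplication: $\langle a_i^{-1}\rangle\cdot\langle b_i^{-1}\rangle=\langle (b_ia_i)^{-1}\rangle$; $\langle a_i^{-1}\rangle\cdot\langle f_j\rangle=\langle a_{\lambda(j)}^{-1}f_j\vee e\rangle_{j\in J}$; $\langle f_j\rangle\cdot\langle a_i^{-1}\rangle=\langle f_ja_{\rho(j)}^{-1}\vee e\rangle_{j\in J}$; $\langle f_j\rangle\cdot\langle g_j\rangle=0$. Divisions: $\langle a_i^{-1}\rangle\backslash\langle b_i^{-1}\rangle=\langle a_ib_i^{-1}\wedge e^{-1}\rangle$; $\langle b_i^{-1}\rangle/\langle a_i^{-1}\rangle=\langle b_i^{-1}a_i\wedge e^{-1}\rangle$; $\langle a_i^{-1}\rangle\backslash\langle f_j\rangle=\langle a_{\lambda(j)}f_j\rangle_{j}$; $\langle f_j\rangle/\langle a_i^{-1}\rangle=\langle f_ja_{\rho(j)}\rangle_{j}$; $\langle f_j\rangle\backslash\langle g_j\rangle$ is the element of $(G^-)^I$ whose $i$-th coordinate is $f_{\rho^{-1}(i)}^{-1}g_{\rho^{-1}(i)}\wedge e^{-1}$ if $i\in\rho(J)$ and $e^{-1}$ otherwise; $\langle g_j\rangle/\langle f_j\rangle$ is the element of $(G^-)^I$ whose $i$-th coordinate is $g_{\lambda^{-1}(i)}f_{\lambda^{-1}(i)}^{-1}\wedge e^{-1}$ if $i\in\lambda(J)$ and $e^{-1}$ otherwise; $\langle a_i^{-1}\rangle/\langle f_j\rangle=1=\langle f_j\rangle\backslash\langle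 a_i^{-1}\rangle$. Natural numbers are identified with ordinals, $n=\{0,\dots,n-1\}$, and $\omega=\{0,1,2,\dots\}$. In the list, the first lower index is $I$ and the second is $J$.
   Formalization: The uniqueness in "precisely one" and the "only if" in "type (5) is good iff J=∅" are stated for nontrivial G; over the one-element ℓ-group every kite is the two-element Boolean algebra, so both fail there. *)

theory Defs
  imports "HOL-Algebra.Group"
begin

section \<open>FL-algebras, pseudo BL-algebras and pseudo MV-algebras\<close>

text \<open>\<open>ldiv A x y\<close> is $x \backslash y$ and \<open>rdiv A y x\<close> is $y / x$; the constant \<open>1\<close> is the monoid
  unit \<open>\<one>\<close>.\<close>

record 'a fl_sig = "'a monoid" +
  fl_meet :: "'a \<Rightarrow> 'a \<Rightarrow> 'a"
  fl_join :: "'a \<Rightarrow> 'a \<Rightarrow> 'a"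
  ldiv :: "'a \<Rightarrow> 'a \<Rightarrow> 'a"
  rdiv :: "'a \<Rightarrow> 'a \<Rightarrow> 'a"
  fl_zero :: 'a

definition fl_le :: "'a fl_sig \<Rightarrow> 'a \<Rightarrow> 'a \<Rightarrow> bool" where
  "fl_le A x y \<longleftrightarrow> fl_meet A x y = x"

locale fl_algebra = monoid A for A :: "'a fl_sig" (structure) +
  assumes meet_closed: "\<lbrakk>x \<in> carrier A; y \<in> carrier A\<rbrakk> \<Longrightarrow> fl_meet A x y \<in> carrier A"
    and join_closed: "\<lbrakk>x \<in> carrier A; y \<in> carrier A\<rbrakk> \<Longrightarrow> fl_join A x y \<in> carrier A"
    and ldiv_closed: "\<lbrakk>x \<in> carrier A; y \<in> carrier A\<rbrakk> \<Longrightarrow> ldiv A x y \<in> carrier A"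
    and rdiv_closed: "\<lbrakk>x \<in> carrier A; y \<in> carrier A\<rbrakk> \<Longrightarrow> rdiv A x y \<in> carrier A"
    and zero_closed: "fl_zero A \<in> carrier A"
    and meet_comm: "\<lbrakk>x \<in> carrier A; y \<in> carrier A\<rbrakk> \<Longrightarrow> fl_meet A x y = fl_meet A y x"
    and join_comm: "\<lbrakk>x \<in> carrier A; y \<in> carrier A\<rbrakk> \<Longrightarrow> fl_join A x y = fl_join A y x"
    and meet_assoc: "\<lbrakk>x \<in> carrier A; y \<in> carrier A; z \<in> carrier A\<rbrakk>
      \<Longrightarrow> fl_meet A (fl_meet A x y) z = fl_meet A x (fl_meet A y z)"
    and join_assoc: "\<lbrakk>x \<in> carrier A; y \<in> carrier A; z \<in> carrier A\<rbrakk>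
      \<Longrightarrow> fl_join A (fl_join A x y) z = fl_join A x (fl_join A y z)"
    and meet_join_absorb: "\<lbrakk>x \<in> carrier A; y \<in> carrier A\<rbrakk> \<Longrightarrow> fl_meet A x (fl_join A x y) = x"
    and join_meet_absorb: "\<lbrakk>x \<in> carrier A; y \<in> carrier A\<rbrakk> \<Longrightarrow> fl_join A x (fl_meet A x y) = x"
    and ldiv_residual: "\<lbrakk>x \<in> carrier A; y \<in> carrier A; z \<in> carrier A\<rbrakk>
      \<Longrightarrow> fl_le A (x \<otimes> y) z \<longleftrightarrow> fl_le A y (ldiv A x z)"
    and rdiv_residual: "\<lbrakk>x \<in> carrier A; y \<in> carrier A; z \<in> carrier A\<rbrakk>
      \<Longrightarrow> fl_le A (x \<otimes> y) z \<longleftrightarrow> fl_le A x (rdiv A z y)"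

locale pseudo_bl = fl_algebra +
  assumes zero_le: "x \<in> carrier A \<Longrightarrow> fl_le A (fl_zero A) x"
    and le_one: "x \<in> carrier A \<Longrightarrow> fl_le A x \<one>"
    and ldivisibility: "\<lbrakk>x \<in> carrier A; y \<in> carrier A\<rbrakk>
      \<Longrightarrow> x \<otimes> ldiv A x (fl_meet A x y) = fl_meet A x y"
    and rdivisibility: "\<lbrakk>x \<in> carrier A; y \<in> carrier A\<rbrakk>
      \<Longrightarrow> rdiv A (fl_meet A x y) x \<otimes> x = fl_meet A x y"
    and lprelinearity: "\<lbrakk>x \<in> carrier A; y \<in> carrier A\<rbrakk>
      \<Longrightarrow> fl_join A (ldiv A x y) (ldiv A y x) = \<one>"
    and rprelinearity: "\<lbrakk>x \<in> carrier A; y \<in> carrier A\<rbrakk>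
      \<Longrightarrow> fl_join A (rdiv A y x) (rdiv A x y) = \<one>"

locale pseudo_mv = pseudo_bl +
  assumes rdiv_ldiv_join: "\<lbrakk>x \<in> carrier A; y \<in> carrier A\<rbrakk>
      \<Longrightarrow> rdiv A x (ldiv A y x) = fl_join A x y"
    and rdiv_ldiv_join': "\<lbrakk>x \<in> carrier A; y \<in> carrier A\<rbrakk>
      \<Longrightarrow> ldiv A (rdiv A x y) x = fl_join A x y"

definition lneg :: "'a fl_sig \<Rightarrow> 'a \<Rightarrow> 'a" where
  "lneg A x = ldiv A x (fl_zero A)"

definition rneg :: "'a fl_sig \<Rightarrow> 'a \<Rightarrow> 'a" where
  "rneg A x = rdiv A (fl_zero A) x"

locale good_pseudo_bl = pseudo_bl +
  assumes good: "x \<in> carrier A \<Longrightarrow> lneg A (rneg A x) = rneg A (lneg A x)"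

definition bool_fl :: "bool fl_sig" where
  "bool_fl = \<lparr>carrier = UNIV, mult = (\<and>), one = True, fl_meet = (\<and>), fl_join = (\<or>),
     ldiv = (\<lambda>x y. x \<longrightarrow> y), rdiv = (\<lambda>y x. x \<longrightarrow> y), fl_zero = False\<rparr>"


section \<open>Homomorphisms and subdirect irreducibility\<close>

definition fl_hom :: "'a fl_sig \<Rightarrow> 'b fl_sig \<Rightarrow> ('a \<Rightarrow> 'b) set" where
  "fl_hom A B = {h. h \<in> carrier A \<rightarrow> carrier B \<and>
     (\<forall>x\<in>carrier A. \<forall>y\<in>carrier A.
        h (x \<otimes>\<^bsub>A\<^esub> y) = h x \<otimes>\<^bsub>B\<^esub> h y \<and>
        h (fl_meet A x y) = fl_meet B (h x) (h y) \<and>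
        h (fl_join A x y) = fl_join B (h x) (h y) \<and>
        h (ldiv A x y) = ldiv B (h x) (h y) \<and>
        h (rdiv A x y) = rdiv B (h x) (h y)) \<and>
     h \<one>\<^bsub>A\<^esub> = \<one>\<^bsub>B\<^esub> \<and> h (fl_zero A) = fl_zero B}"

definition fl_iso :: "'a fl_sig \<Rightarrow> 'b fl_sig \<Rightarrow> ('a \<Rightarrow> 'b) set" where
  "fl_iso A B = {h \<in> fl_hom A B. bij_betw h (carrier A) (carrier B)}"

definition fl_isomorphic :: "'a fl_sig \<Rightarrow> 'b fl_sig \<Rightarrow> bool" where
  "fl_isomorphic A B \<longleftrightarrow> fl_iso A B \<noteq> {}"

text \<open>An embedding of \<open>A\<close> into the direct product of the \<open>B k\<close> (\<open>k \<in> S\<close>), given by its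
  coordinate maps \<open>h k\<close>, all of which are onto.\<close>

definition subdirect_embedding ::
    "'a fl_sig \<Rightarrow> 'k set \<Rightarrow> ('k \<Rightarrow> 'b fl_sig) \<Rightarrow> ('k \<Rightarrow> 'a \<Rightarrow> 'b) \<Rightarrow> bool" where
  "subdirect_embedding A S B h \<longleftrightarrow>
     (\<forall>k\<in>S. h k \<in> fl_hom A (B k) \<and> h k ` carrier A = carrier (B k)) \<and>
     (\<forall>x\<in>carrier A. \<forall>y\<in>carrier A. (\<forall>k\<in>S. h k x = h k y) \<longrightarrow> x = y)"

text \<open>An algebra is subdirectly irreducible if in each of its subdirect embeddings some
  coordinate map is an isomorphism.  A definition can only quantify over families of a fixed type;
  here the factors live on the type of \<open>A\<close> and are indexed by pairs of elements of \<open>A\<close>.  This is no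
  restriction: \<open>subdirectly_irreducibleD\<close> below gives the property for families of arbitrary
  types.\<close>

definition subdirectly_irreducible :: "'a fl_sig \<Rightarrow> bool" where
  "subdirectly_irreducible A \<longleftrightarrow>
     (\<forall>(S :: ('a \<times> 'a) set) (B :: 'a \<times> 'a \<Rightarrow> 'a fl_sig) h.
        subdirect_embedding A S B h \<longrightarrow> (\<exists>k\<in>S. h k \<in> fl_iso A (B k)))"

lemma hom_image_copy:
  fixes A :: "'a fl_sig" and B :: "'b fl_sig"
  assumes h: "h \<in> fl_hom A B" and onto: "h ` carrier A = carrier B"
  obtains C :: "'a fl_sig" and r :: "'b \<Rightarrow> 'a"
  where "inj_on r (carrier B)" "r \<circ> h \<in> fl_hom A C" "(r \<circ> h) ` carrier A = carrier C"
proof -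
  define r where "r = inv_into (carrier A) h"
  have r: "r y \<in> carrier A" "h (r y) = y" if "y \<in> carrier B" for y
    using that onto unfolding r_def by (auto intro: inv_into_into f_inv_into_f)
  define C where "C = \<lparr>carrier = r ` carrier B,
    mult = (\<lambda>x y. r (h x \<otimes>\<^bsub>B\<^esub> h y)), one = r \<one>\<^bsub>B\<^esub>,
    fl_meet = (\<lambda>x y. r (fl_meet B (h x) (h y))), fl_join = (\<lambda>x y. r (fl_join B (h x) (h y))),
    ldiv = (\<lambda>x y. r (ldiv B (h x) (h y))), rdiv = (\<lambda>x y. r (rdiv B (h x) (h y))),
    fl_zero = r (fl_zero B)\<rparr>"
  have hB: "h x \<in> carrier B" if "x \<in> carrier A" for x using that onto by blast
  have "inj_on r (carrier B)" by (metis inj_onI r(2))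
  moreover have "r \<circ> h \<in> fl_hom A C"
    using h by (simp add: fl_hom_def C_def r hB Pi_iff)
  moreover have "(r \<circ> h) ` carrier A = carrier C"
    unfolding C_def onto[symmetric] by (simp add: image_comp)
  ultimately show ?thesis using that by blast
qed

lemma subdirectly_irreducibleD:
  fixes A :: "'a fl_sig" and S :: "'k set" and B :: "'k \<Rightarrow> 'b fl_sig"
  assumes SI: "subdirectly_irreducible A" and sub: "subdirect_embedding A S B h"
  shows "\<exists>k\<in>S. h k \<in> fl_iso A (B k)"
proof -
  define P where "P = {(a, b). a \<in> carrier A \<and> b \<in> carrier A \<and> a \<noteq> b}"
  have "\<exists>k. k \<in> S \<and> h k (fst p) \<noteq> h k (snd p)" if "p \<in> P" for p
  proof -
    have "fst p \<in> carrier A" "snd p \<in> carrier A" "fst p \<noteq> snd p"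
      using that by (auto simp: P_def)
    then show ?thesis using sub unfolding subdirect_embedding_def by blast
  qed
  then have "\<exists>c. \<forall>p\<in>P. c p \<in> S \<and> h (c p) (fst p) \<noteq> h (c p) (snd p)"
    by (intro bchoice) blast
  then obtain c where c: "\<And>p. p \<in> P \<Longrightarrow> c p \<in> S"
    "\<And>p. p \<in> P \<Longrightarrow> h (c p) (fst p) \<noteq> h (c p) (snd p)" by blast
  define Q where "Q p C r \<longleftrightarrow> inj_on r (carrier (B (c p))) \<and> r \<circ> h (c p) \<in> fl_hom A C \<and>
      (r \<circ> h (c p)) ` carrier A = carrier C" for p and C :: "'a fl_sig" and r
  have "\<exists>D. Q p (fst D) (snd D)" if "p \<in> P" for p
  proof -
    have "h (c p) \<in> fl_hom A (B (c p))" "h (c p) ` carrier A = carrier (B (c p))"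
      using sub c(1)[OF that] unfolding subdirect_embedding_def by auto
    then obtain C :: "'a fl_sig" and r where "Q p C r"
      unfolding Q_def by (rule hom_image_copy) blast
    then show ?thesis by (intro exI[of _ "(C, r)"]) simp
  qed
  then have "\<exists>D. \<forall>p\<in>P. Q p (fst (D p)) (snd (D p))" by (intro bchoice) blast
  then obtain D where D: "\<And>p. p \<in> P \<Longrightarrow> Q p (fst (D p)) (snd (D p))" by blast
  define C where "C p = fst (D p)" for p
  define r where "r p = snd (D p)" for p
  have C: "inj_on (r p) (carrier (B (c p)))" "r p \<circ> h (c p) \<in> fl_hom A (C p)"
    "(r p \<circ> h (c p)) ` carrier A = carrier (C p)" if "p \<in> P" for p
    using D[OF that] unfolding Q_def C_def r_def by auto
  have hB: "h (c p) x \<in> carrier (B (c p))" if "p \<in> P" "x \<in> carrier A" for p x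
    using sub c(1)[OF that(1)] that(2) unfolding subdirect_embedding_def by blast
  have "subdirect_embedding A P C (\<lambda>p. r p \<circ> h (c p))"
    unfolding subdirect_embedding_def
  proof (intro conjI ballI impI)
    fix x y assume xy: "x \<in> carrier A" "y \<in> carrier A"
      and eq: "\<forall>p\<in>P. (r p \<circ> h (c p)) x = (r p \<circ> h (c p)) y"
    show "x = y"
    proof (rule ccontr)
      assume "x \<noteq> y"
      then have p: "(x, y) \<in> P" using xy by (simp add: P_def)
      have "h (c (x, y)) x = h (c (x, y)) y"
      proof (rule inj_onD[OF C(1)[OF p]])
        show "r (x, y) (h (c (x, y)) x) = r (x, y) (h (c (x, y)) y)"
          using bspec[OF eq p] by (simp only: comp_apply)
      qed (use hB[OF p] xy in auto)
      then show False using c(2)[OF p] by simp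
    qed
  qed (use C in auto)
  then obtain p where p: "p \<in> P" "r p \<circ> h (c p) \<in> fl_iso A (C p)"
    using SI unfolding subdirectly_irreducible_def by blast
  then have "inj_on (h (c p)) (carrier A)"
    unfolding fl_iso_def bij_betw_def using inj_on_imageI2 by blast
  then have "h (c p) \<in> fl_iso A (B (c p))"
    using sub c(1)[OF p(1)] unfolding subdirect_embedding_def fl_iso_def bij_betw_def by blast
  then show ?thesis using c(1)[OF p(1)] by blast
qed


section \<open>Kites\<close>

text \<open>Lattice-ordered groups are written additively, so that \<open>0\<close>, \<open>+\<close> and \<open>-\<close> stand for
  $e$, multiplication and inversion of $\mathbf{G}$; \<open>+\<close> need not be commutative.\<close>

class lattice_group_add = group_add + lattice +
  assumes lg_add_left_mono: "a \<le> b \<Longrightarrow> c + a \<le> c + b"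
    and lg_add_right_mono: "a \<le> b \<Longrightarrow> a + c \<le> b + c"

text \<open>\<open>Inl f\<close> is the element $\langle f_j\rangle_{j\in J}$ of $(G^+)^J$, and \<open>Inr x\<close> is the element
  $\langle a_i^{-1}\rangle_{i\in I}$ of $(G^-)^I$ with \<open>x i\<close> equal to $a_i^{-1}$ (not to $a_i$).\<close>

type_synonym ('i, 'j, 'g) kite_elem = "('j \<Rightarrow> 'g) + ('i \<Rightarrow> 'g)"

definition kite_carrier ::
    "'i set \<Rightarrow> 'j set \<Rightarrow> ('i, 'j, 'g::lattice_group_add) kite_elem set" where
  "kite_carrier I J = (J \<rightarrow>\<^sub>E {0..}) <+> (I \<rightarrow>\<^sub>E {..0})"

fun kite_meet :: "'i set \<Rightarrow> 'j set \<Rightarrow> ('i, 'j, 'g::lattice_group_add) kite_elem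
    \<Rightarrow> ('i, 'j, 'g) kite_elem \<Rightarrow> ('i, 'j, 'g) kite_elem" where
  "kite_meet I J (Inr x) (Inr y) = Inr (\<lambda>i\<in>I. inf (x i) (y i))"
| "kite_meet I J (Inr x) (Inl f) = Inl f"
| "kite_meet I J (Inl f) (Inr x) = Inl f"
| "kite_meet I J (Inl f) (Inl g) = Inl (\<lambda>j\<in>J. inf (f j) (g j))"

fun kite_join :: "'i set \<Rightarrow> 'j set \<Rightarrow> ('i, 'j, 'g::lattice_group_add) kite_elem
    \<Rightarrow> ('i, 'j, 'g) kite_elem \<Rightarrow> ('i, 'j, 'g) kite_elem" where
  "kite_join I J (Inr x) (Inr y) = Inr (\<lambda>i\<in>I. sup (x i) (y i))"
| "kite_join I J (Inr x) (Inl f) = Inr x"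
| "kite_join I J (Inl f) (Inr x) = Inr x"
| "kite_join I J (Inl f) (Inl g) = Inl (\<lambda>j\<in>J. sup (f j) (g j))"

fun kite_mult :: "'i set \<Rightarrow> 'j set \<Rightarrow> ('j \<Rightarrow> 'i) \<Rightarrow> ('j \<Rightarrow> 'i)
    \<Rightarrow> ('i, 'j, 'g::lattice_group_add) kite_elem
    \<Rightarrow> ('i, 'j, 'g) kite_elem \<Rightarrow> ('i, 'j, 'g) kite_elem" where
  "kite_mult I J lam rho (Inr x) (Inr y) = Inr (\<lambda>i\<in>I. x i + y i)"
| "kite_mult I J lam rho (Inr x) (Inl f) = Inl (\<lambda>j\<in>J. sup (x (lam j) + f j) 0)"
| "kite_mult I J lam rho (Inl f) (Inr x) = Inl (\<lambda>j\<in>J. sup (f j + x (rho j)) 0)"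
| "kite_mult I J lam rho (Inl f) (Inl g) = Inl (\<lambda>j\<in>J. 0)"

fun kite_ldiv :: "'i set \<Rightarrow> 'j set \<Rightarrow> ('j \<Rightarrow> 'i) \<Rightarrow> ('j \<Rightarrow> 'i)
    \<Rightarrow> ('i, 'j, 'g::lattice_group_add) kite_elem
    \<Rightarrow> ('i, 'j, 'g) kite_elem \<Rightarrow> ('i, 'j, 'g) kite_elem" where
  "kite_ldiv I J lam rho (Inr x) (Inr y) = Inr (\<lambda>i\<in>I. inf (- x i + y i) 0)"
| "kite_ldiv I J lam rho (Inr x) (Inl f) = Inl (\<lambda>j\<in>J. - x (lam j) + f j)"
| "kite_ldiv I J lam rho (Inl f) (Inr x) = Inr (\<lambda>i\<in>I. 0)"
| "kite_ldiv I J lam rho (Inl f) (Inl g) = Inr (\<lambda>i\<in>I. if i \<in> rho ` J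
      then inf (- f (the_inv_into J rho i) + g (the_inv_into J rho i)) 0 else 0)"

text \<open>As for \<open>rdiv\<close>, the dividend comes first: \<open>kite_rdiv I J lam rho u v\<close> is $u / v$.\<close>

fun kite_rdiv :: "'i set \<Rightarrow> 'j set \<Rightarrow> ('j \<Rightarrow> 'i) \<Rightarrow> ('j \<Rightarrow> 'i)
    \<Rightarrow> ('i, 'j, 'g::lattice_group_add) kite_elem
    \<Rightarrow> ('i, 'j, 'g) kite_elem \<Rightarrow> ('i, 'j, 'g) kite_elem" where
  "kite_rdiv I J lam rho (Inr y) (Inr x) = Inr (\<lambda>i\<in>I. inf (y i - x i) 0)"
| "kite_rdiv I J lam rho (Inl f) (Inr x) = Inl (\<lambda>j\<in>J. f j - x (rho j))"
| "kite_rdiv I J lam rho (Inr x) (Inl f) = Inr (\<lambda>i\<in>I. 0)"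
| "kite_rdiv I J lam rho (Inl g) (Inl f) = Inr (\<lambda>i\<in>I. if i \<in> lam ` J
      then inf (g (the_inv_into J lam i) - f (the_inv_into J lam i)) 0 else 0)"

definition kite :: "'g itself \<Rightarrow> 'i set \<Rightarrow> 'j set \<Rightarrow> ('j \<Rightarrow> 'i) \<Rightarrow> ('j \<Rightarrow> 'i)
    \<Rightarrow> ('i, 'j, 'g::lattice_group_add) kite_elem fl_sig" where
  "kite G I J lam rho = \<lparr>carrier = kite_carrier I J,
     mult = kite_mult I J lam rho, one = Inr (\<lambda>i\<in>I. 0),
     fl_meet = kite_meet I J, fl_join = kite_join I J,
     ldiv = kite_ldiv I J lam rho, rdiv = kite_rdiv I J lam rho, fl_zero = Inl (\<lambda>j\<in>J. 0)\<rparr>"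

text \<open>The condition $|J| \le |I|$ is implied by the existence of an injection.\<close>

definition kite_data :: "'i set \<Rightarrow> 'j set \<Rightarrow> ('j \<Rightarrow> 'i) \<Rightarrow> ('j \<Rightarrow> 'i) \<Rightarrow> bool" where
  "kite_data I J lam rho \<longleftrightarrow>
     lam \<in> J \<rightarrow> I \<and> inj_on lam J \<and> rho \<in> J \<rightarrow> I \<and> inj_on rho J"

definition kite1 :: "'g::lattice_group_add itself \<Rightarrow> nat \<Rightarrow> (nat, nat, 'g) kite_elem fl_sig" where
  "kite1 G n = kite G {..<n} {..<n} (\<lambda>j. j) (\<lambda>j. (j + 1) mod n)"

definition kite2 :: "'g::lattice_group_add itself \<Rightarrow> (int, int, 'g) kite_elem fl_sig" where
  "kite2 G = kite G UNIV UNIV (\<lambda>j. j) (\<lambda>j. j + 1)"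

definition kite3 :: "'g::lattice_group_add itself \<Rightarrow> (nat, nat, 'g) kite_elem fl_sig" where
  "kite3 G = kite G UNIV UNIV (\<lambda>j. j) (\<lambda>j. j + 1)"

definition kite4 :: "'g::lattice_group_add itself \<Rightarrow> (nat, nat, 'g) kite_elem fl_sig" where
  "kite4 G = kite G UNIV UNIV (\<lambda>j. j + 1) (\<lambda>j. j)"

definition kite5 :: "'g::lattice_group_add itself \<Rightarrow> nat \<Rightarrow> (nat, nat, 'g) kite_elem fl_sig" where
  "kite5 G n = kite G {..<n + 1} {..<n} (\<lambda>j. j) (\<lambda>j. j + 1)"

text \<open>Names for the entries of the list; the kites themselves have different HOL types.\<close>

datatype kite_type = Type1 nat | Type2 | Type3 | Type4 | Type5 nat

primrec isomorphic_to_type ::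
    "'g::lattice_group_add itself \<Rightarrow> 'a fl_sig \<Rightarrow> kite_type \<Rightarrow> bool" where
  "isomorphic_to_type G A (Type1 n) \<longleftrightarrow> fl_isomorphic A (kite1 G n)"
| "isomorphic_to_type G A Type2 \<longleftrightarrow> fl_isomorphic A (kite2 G)"
| "isomorphic_to_type G A Type3 \<longleftrightarrow> fl_isomorphic A (kite3 G)"
| "isomorphic_to_type G A Type4 \<longleftrightarrow> fl_isomorphic A (kite4 G)"
| "isomorphic_to_type G A (Type5 n) \<longleftrightarrow> fl_isomorphic A (kite5 G n)"

end

theory Submission
  imports Defs
begin

text \<open>
  A kite is determined, up to isomorphism, by the directed graph on \<open>I\<close> with an edge from
  \<open>lam j\<close> to \<open>rho j\<close> for each \<open>j\<close> in \<open>J\<close>. A union of connected components of this graph yields a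
  quotient of the kite by restricting all sequences, and the restrictions to such a union and to
  its complement separate points; so the graph of a subdirectly irreducible kite over a nontrivial
  group is connected. Since \<open>lam\<close> and \<open>rho\<close> are injective, all in-degrees and out-degrees are at most
  one, and a connected graph of this kind is a cycle, a finite path, or one of the three infinite
  paths.

  The type is read off from the algebra: \<open>lneg x = 0\<close> forces \<open>x = 1\<close> iff \<open>lam\<close> is onto \<open>I\<close>,
  symmetrically for \<open>rneg\<close> and \<open>rho\<close>, and the double negation \<open>lneg \<circ> lneg\<close> moves coordinates
  one step along the edges, so its order gives the length of a cycle and its nilpotency
  index the length of a finite path.
\<close>

section \<open>Lattice-ordered groups\<close>

context lattice_group_add
begin

lemma lg_le_minus_add_iff: "a \<le> - c + b \<longleftrightarrow> c + a \<le> b"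
proof
  assume "a \<le> - c + b"
  then show "c + a \<le> b"
    using lg_add_left_mono[of a "- c + b" c] by (simp add: add.assoc[symmetric])
next
  assume "c + a \<le> b"
  then show "a \<le> - c + b"
    using lg_add_left_mono[of "c + a" b "- c"] by (simp add: add.assoc[symmetric])
qed

lemma lg_le_diff_iff: "a \<le> b - c \<longleftrightarrow> a + c \<le> b"
proof
  assume "a \<le> b - c"
  then show "a + c \<le> b"
    using lg_add_right_mono[of a "b - c" c] by (simp add: add.assoc)
next
  assume "a + c \<le> b"
  then show "a \<le> b - c"
    using lg_add_right_mono[of "a + c" b "- c"] by (simp add: add.assoc)
qed

lemma lg_add_le_cancel_left: "c + a \<le> c + b \<longleftrightarrow> a \<le> b"
  using lg_le_minus_add_iff[of a c "c + b"] by (simp add: add.assoc[symmetric])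

lemma lg_add_le_cancel_right: "a + c \<le> b + c \<longleftrightarrow> a \<le> b"
  using lg_le_diff_iff[of a "b + c" c] by simp

lemma lg_neg_le_iff: "- a \<le> - b \<longleftrightarrow> b \<le> a"
proof -
  have "- a \<le> - b \<longleftrightarrow> b + - a \<le> 0"
    using lg_le_minus_add_iff[of "- a" b 0] by (simp only: add_0_right)
  also have "\<dots> \<longleftrightarrow> b + - a + a \<le> 0 + a"
    by (simp only: lg_add_le_cancel_right)
  finally show ?thesis by (simp add: add.assoc)
qed

lemma lg_neg_nonneg_iff: "0 \<le> - a \<longleftrightarrow> a \<le> 0"
  using lg_neg_le_iff[of 0 a] by simp

lemma lg_neg_nonpos_iff: "- a \<le> 0 \<longleftrightarrow> 0 \<le> a"
  using lg_neg_le_iff[of a 0] by simp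

text \<open>Translation by \<open>c\<close> is monotone with monotone inverse, so it preserves
  joins; the nontrivial inequality is checked after moving \<open>c\<close> to the other
  side.\<close>

lemma lg_add_sup_left: "c + sup a b = sup (c + a) (c + b)"
proof (rule order.antisym)
  show "c + sup a b \<le> sup (c + a) (c + b)"
    by (intro iffD1[OF lg_le_minus_add_iff] le_supI)
      (simp_all only: lg_le_minus_add_iff sup_ge1 sup_ge2)
qed (simp add: lg_add_le_cancel_left)

lemma lg_add_sup_right: "sup a b + c = sup (a + c) (b + c)"
proof (rule order.antisym)
  show "sup a b + c \<le> sup (a + c) (b + c)"
    by (intro iffD1[OF lg_le_diff_iff] le_supI)
      (simp_all only: lg_le_diff_iff sup_ge1 sup_ge2)
qed (simp add: lg_add_le_cancel_right)

lemma lg_neg_sup: "- sup a b = inf (- a) (- b)"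
proof (rule order.antisym)
  have "- (- a) \<le> - inf (- a) (- b)" "- (- b) \<le> - inf (- a) (- b)"
    by (simp_all only: lg_neg_le_iff inf_le1 inf_le2)
  then have "- (- sup a b) \<le> - inf (- a) (- b)" by simp
  then show "inf (- a) (- b) \<le> - sup a b" by (simp only: lg_neg_le_iff)
qed (simp add: lg_neg_le_iff)

lemma lg_neg_inf: "- inf a b = sup (- a) (- b)"
  using lg_neg_sup[of "- a" "- b"] by (metis minus_minus)

lemma lg_add_inf_left: "c + inf a b = inf (c + a) (c + b)"
proof -
  have "- (c + inf a b) = - inf (c + a) (c + b)"
    by (simp only: lg_neg_inf minus_add lg_add_sup_right)
  then show ?thesis by (simp only: neg_equal_iff_equal)
qed

lemma lg_add_inf_right: "inf a b + c = inf (a + c) (b + c)"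
proof -
  have "- (inf a b + c) = - inf (a + c) (b + c)"
    by (simp only: lg_neg_inf minus_add lg_add_sup_left)
  then show ?thesis by (simp only: neg_equal_iff_equal)
qed

text \<open>The second term is the first one translated by \<open>- a\<close>. Taking out
  \<open>inf a 0\<close> leaves \<open>sup 0 (- a)\<close>, which is its inverse. Prelinearity of
  kites rests on this.\<close>

lemma lg_sup_inf_neg: "sup (inf a 0) (inf (- a) 0) = 0"
proof -
  have "inf (- a) 0 = inf a 0 + - a"
    by (simp only: lg_add_inf_right right_minus add_0_left inf_commute)
  then have "sup (inf a 0) (inf (- a) 0) = inf a 0 + sup 0 (- a)"
    by (simp only: lg_add_sup_left add_0_right)
  also have "sup 0 (- a) = - inf a 0"
    by (simp only: lg_neg_inf minus_zero sup_commute)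
  finally show ?thesis by (simp only: right_minus)
qed

text \<open>If the negative parts of \<open>g\<close> and of \<open>- g\<close> both vanish, then
  \<open>g\<close> and \<open>- g\<close> are nonnegative and \<open>g = 0\<close>. The element
  \<open>h\<close> supplies the test sequences in (G^-)^I that tell kites over nontrivial groups
  apart.\<close>

lemma lg_negative_exists:
  assumes "g \<noteq> 0"
  obtains h where "h \<le> 0" "h \<noteq> 0"
proof (cases "inf g 0 = 0 \<and> inf (- g) 0 = 0")
  case True
  then have "0 \<le> g" "0 \<le> - g" by (metis inf_le1)+
  then have "g = 0" by (simp add: lg_neg_nonneg_iff)
  with assms show ?thesis by simp
next
  case False
  then show ?thesis using that[of "inf g 0"] that[of "inf (- g) 0"] by auto
qed

lemma lg_add_nonneg: "0 \<le> a \<Longrightarrow> 0 \<le> b \<Longrightarrow> 0 \<le> a + b"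
  using lg_add_left_mono[of 0 b a] by simp

lemma lg_add_nonpos: "a \<le> 0 \<Longrightarrow> b \<le> 0 \<Longrightarrow> a + b \<le> 0"
  using lg_add_left_mono[of b 0 a] by simp

lemma lg_diff_nonneg: "0 \<le> a \<Longrightarrow> b \<le> 0 \<Longrightarrow> 0 \<le> a - b"
  using lg_add_nonneg[of a "- b"] by (simp add: lg_neg_nonneg_iff)

lemma lg_minus_add_nonneg: "b \<le> 0 \<Longrightarrow> 0 \<le> a \<Longrightarrow> 0 \<le> - b + a"
  using lg_add_nonneg[of "- b" a] by (simp add: lg_neg_nonneg_iff)

text \<open>This identity and the next are divisibility in one coordinate; the two after them are
  the pseudo MV laws in one coordinate.\<close>

lemma lg_add_inf_self: "a + inf (- a + b) 0 = inf b a"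
  by (simp add: lg_add_inf_left add.assoc[symmetric])

lemma lg_inf_diff_add_self: "inf (b - a) 0 + a = inf b a"
  by (simp add: lg_add_inf_right add.assoc)

lemma lg_diff_inf_self: "a - inf (- b + a) 0 = sup b a"
  by (simp only: diff_conv_add_uminus lg_neg_inf lg_add_sup_left minus_add minus_minus
      minus_zero add_0_right add.assoc[symmetric] right_minus add_0_left)

lemma lg_neg_inf_add_self: "- inf (a - b) 0 + a = sup b a"
  by (simp only: diff_conv_add_uminus lg_neg_inf lg_add_sup_right minus_add minus_minus
      minus_zero add_0_left add.assoc left_minus add_0_right)

text \<open>Since \<open>y\<close> is nonpositive, truncating at 0 before adding it is absorbed by
  the truncation afterwards. Associativity of the kite product needs this whenever exactly one
  factor lies in (G^+)^J.\<close>

lemma lg_sup_sup_add_right: "y \<le> 0 \<Longrightarrow> sup (sup a 0 + y) 0 = sup (a + y) 0"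
  by (simp add: lg_add_sup_right sup_assoc sup_absorb2)

lemma lg_sup_add_sup_left: "y \<le> 0 \<Longrightarrow> sup (y + sup a 0) 0 = sup (y + a) 0"
  by (simp add: lg_add_sup_left sup_assoc sup_absorb2)

end

section \<open>Kites as pseudo BL-algebras\<close>

lemma restrict_eq_iff:
  "restrict f S = restrict g S \<longleftrightarrow> (\<forall>s\<in>S. f s = g s)"
  by (metis restrict_apply restrict_ext)

lemma restrict_eq_extensional_iff:
  assumes "g \<in> extensional S"
  shows "restrict f S = g \<longleftrightarrow> (\<forall>s\<in>S. f s = g s)"
    and "g = restrict f S \<longleftrightarrow> (\<forall>s\<in>S. f s = g s)"
  using assms by (metis restrict_eq_iff extensional_restrict)+

lemma Inl_in_kite_carrier [simp]:
  "Inl f \<in> kite_carrier I J \<longleftrightarrow> (\<forall>j\<in>J. 0 \<le> f j) \<and> f \<in> extensional J"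
  by (auto simp: kite_carrier_def PiE_def Pi_iff)

lemma Inr_in_kite_carrier [simp]:
  "Inr x \<in> kite_carrier I J \<longleftrightarrow> (\<forall>i\<in>I. x i \<le> 0) \<and> x \<in> extensional I"
  by (auto simp: kite_carrier_def PiE_def Pi_iff)

lemma kite_carrierE:
  assumes "u \<in> kite_carrier I J"
  obtains f where "u = Inl f" "\<And>j. j \<in> J \<Longrightarrow> 0 \<le> f j" "f \<in> extensional J"
  | x where "u = Inr x" "\<And>i. i \<in> I \<Longrightarrow> x i \<le> 0" "x \<in> extensional I"
  using assms by (cases u) auto

lemma kite_sel [simp]:
  "carrier (kite G I J lam rho) = kite_carrier I J"
  "mult (kite G I J lam rho) = kite_mult I J lam rho"
  "one (kite G I J lam rho) = Inr (\<lambda>i\<in>I. 0)"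
  "fl_meet (kite G I J lam rho) = kite_meet I J"
  "fl_join (kite G I J lam rho) = kite_join I J"
  "ldiv (kite G I J lam rho) = kite_ldiv I J lam rho"
  "rdiv (kite G I J lam rho) = kite_rdiv I J lam rho"
  "fl_zero (kite G I J lam rho) = Inl (\<lambda>j\<in>J. 0)"
  by (simp_all add: kite_def)

text \<open>The order is defined by \<open>fl_meet A x y = x\<close>, and the meet of two sequences
  on the same side is a restricted function. Extensionality of the left argument is what allows a
  coordinatewise reading.\<close>

lemma fl_le_kite_simps:
  "x \<in> extensional I \<Longrightarrow>
     fl_le (kite G I J lam rho) (Inr x) (Inr y) \<longleftrightarrow> (\<forall>i\<in>I. x i \<le> y i)"
  "f \<in> extensional J \<Longrightarrow>
     fl_le (kite G I J lam rho) (Inl f) (Inl g) \<longleftrightarrow> (\<forall>j\<in>J. f j \<le> g j)"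
  "fl_le (kite G I J lam rho) (Inl f) (Inr x)"
  "\<not> fl_le (kite G I J lam rho) (Inr x) (Inl f)"
  by (auto simp: fl_le_def restrict_eq_extensional_iff inf.absorb_iff1)

lemma kite_fl_algebra:
  fixes G :: "'g::lattice_group_add itself" and I :: "'i set" and J :: "'j set"
  assumes "kite_data I J lam rho"
  shows "fl_algebra (kite G I J lam rho)"
proof -
  have lam: "lam j \<in> I" "the_inv_into J lam (lam j) = j"
    and rho: "rho j \<in> I" "the_inv_into J rho (rho j) = j" if "j \<in> J" for j
    using that assms by (auto simp: kite_data_def the_inv_into_f_f)
  note [simp] = restrict_eq_extensional_iff restrict_eq_iff lam rho
  \<comment> \<open>A quotient of two elements of (G^+)^J is indexed by \<open>I\<close> and padded
    with 0 outside the image of \<open>rho\<close> or \<open>lam\<close>. A nonpositive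
    \<open>x\<close> meets the padded coordinates for free, which leaves one condition for each
    \<open>j\<close>.\<close>
  have resid:
    "(\<forall>i\<in>I. x i \<le> (if i \<in> rho ` J
        then inf (- f (the_inv_into J rho i) + g (the_inv_into J rho i)) 0 else 0)) \<longleftrightarrow>
      (\<forall>j\<in>J. f j + x (rho j) \<le> g j)" (is "?A \<longleftrightarrow> ?B")
    "(\<forall>i\<in>I. x i \<le> (if i \<in> lam ` J
        then inf (g (the_inv_into J lam i) - f (the_inv_into J lam i)) 0 else 0)) \<longleftrightarrow>
      (\<forall>j\<in>J. x (lam j) + f j \<le> g j)" (is "?C \<longleftrightarrow> ?D")
    if "\<forall>i. i \<in> I \<longrightarrow> x i \<le> 0" for x :: "'i \<Rightarrow> 'g" and f g
  proof -
    have "x (rho j) \<le> inf (- f j + g j) 0" if ?A "j \<in> J" for j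
      using bspec[OF that(1), of "rho j"] that(2) by simp
    then show "?A \<longleftrightarrow> ?B" using that by (auto simp: lg_le_minus_add_iff)
    have "x (lam j) \<le> inf (g j - f j) 0" if ?C "j \<in> J" for j
      using bspec[OF that(1), of "lam j"] that(2) by simp
    then show "?C \<longleftrightarrow> ?D" using that by (auto simp: lg_le_diff_iff)
  qed
  show ?thesis
  proof (unfold_locales, unfold kite_sel)
    fix u v w :: "('i, 'j, 'g) kite_elem"
    assume u: "u \<in> kite_carrier I J" and v: "v \<in> kite_carrier I J"
    show "kite_mult I J lam rho u v \<in> kite_carrier I J"
      using u v by (auto elim!: kite_carrierE simp: lg_add_nonpos)
    show "kite_ldiv I J lam rho u v \<in> kite_carrier I J"
      using u v by (auto elim!: kite_carrierE simp: lg_minus_add_nonneg)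
    show "kite_rdiv I J lam rho u v \<in> kite_carrier I J"
      using u v by (auto elim!: kite_carrierE simp: lg_diff_nonneg)
    show "kite_meet I J u v \<in> kite_carrier I J"
      using u v by (auto elim!: kite_carrierE simp: le_infI1)
    show "kite_join I J u v \<in> kite_carrier I J"
      using u v by (auto elim!: kite_carrierE simp: le_supI1)
    show "kite_meet I J u v = kite_meet I J v u"
      using u v by (auto elim!: kite_carrierE simp: inf_commute)
    show "kite_join I J u v = kite_join I J v u"
      using u v by (auto elim!: kite_carrierE simp: sup_commute)
    show "kite_meet I J u (kite_join I J u v) = u"
      using u v by (auto elim!: kite_carrierE)
    show "kite_join I J u (kite_meet I J u v) = u"
      using u v by (auto elim!: kite_carrierE)
    assume w: "w \<in> kite_carrier I J"
    show "kite_mult I J lam rho (kite_mult I J lam rho u v) w =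
        kite_mult I J lam rho u (kite_mult I J lam rho v w)"
      using u v w
      by (auto elim!: kite_carrierE simp: add.assoc lg_sup_sup_add_right lg_sup_add_sup_left
          sup_absorb2)
    show "kite_meet I J (kite_meet I J u v) w = kite_meet I J u (kite_meet I J v w)"
      using u v w by (auto elim!: kite_carrierE simp: inf_assoc)
    show "kite_join I J (kite_join I J u v) w = kite_join I J u (kite_join I J v w)"
      using u v w by (auto elim!: kite_carrierE simp: sup_assoc)
    show "fl_le (kite G I J lam rho) (kite_mult I J lam rho u v) w \<longleftrightarrow>
        fl_le (kite G I J lam rho) v (kite_ldiv I J lam rho u w)"
      using u v w
      by (auto elim!: kite_carrierE simp: fl_le_kite_simps lg_le_minus_add_iff resid)
    show "fl_le (kite G I J lam rho) (kite_mult I J lam rho u v) w \<longleftrightarrow>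
        fl_le (kite G I J lam rho) u (kite_rdiv I J lam rho w v)"
      using u v w
      by (auto elim!: kite_carrierE simp: fl_le_kite_simps lg_le_diff_iff resid)
  next
    fix u :: "('i, 'j, 'g) kite_elem" assume u: "u \<in> kite_carrier I J"
    show "kite_mult I J lam rho (Inr (\<lambda>i\<in>I. 0)) u = u"
      using u by (auto elim!: kite_carrierE simp: sup_absorb1)
    show "kite_mult I J lam rho u (Inr (\<lambda>i\<in>I. 0)) = u"
      using u by (auto elim!: kite_carrierE simp: sup_absorb1)
  qed (auto)
qed

lemma kite_pseudo_bl:
  fixes G :: "'g::lattice_group_add itself" and I :: "'i set" and J :: "'j set"
  assumes "kite_data I J lam rho"
  shows "pseudo_bl (kite G I J lam rho)"
proof -
  interpret fl_algebra "kite G I J lam rho"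
    using assms by (rule kite_fl_algebra)
  have lam: "lam j \<in> I" "the_inv_into J lam (lam j) = j"
    and rho: "rho j \<in> I" "the_inv_into J rho (rho j) = j" if "j \<in> J" for j
    using that assms by (auto simp: kite_data_def the_inv_into_f_f)
  note [simp] = restrict_eq_extensional_iff restrict_eq_iff lam rho
  \<comment> \<open>\<open>- b + a\<close> is the inverse of \<open>- a + b\<close>, and
    \<open>a - b\<close> that of \<open>b - a\<close>, so both are instances of
    \<open>lg_sup_inf_neg\<close>.\<close>
  have neg: "sup (inf (- a + b) 0) (inf (- b + a) 0) = 0"
    "sup (inf (b - a) 0) (inf (a - b) 0) = 0" for a b :: 'g
    using lg_sup_inf_neg[of "- a + b"] lg_sup_inf_neg[of "b - a"] by (simp_all add: minus_add)
  show ?thesis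
  proof (unfold_locales, unfold kite_sel)
    fix u :: "('i, 'j, 'g) kite_elem" assume u: "u \<in> kite_carrier I J"
    show "fl_le (kite G I J lam rho) (Inl (\<lambda>j\<in>J. 0)) u"
      using u by (auto elim!: kite_carrierE simp: fl_le_kite_simps)
    show "fl_le (kite G I J lam rho) u (Inr (\<lambda>i\<in>I. 0))"
      using u by (auto elim!: kite_carrierE simp: fl_le_kite_simps)
    fix v :: "('i, 'j, 'g) kite_elem" assume v: "v \<in> kite_carrier I J"
    show "kite_mult I J lam rho u (kite_ldiv I J lam rho u (kite_meet I J u v)) =
        kite_meet I J u v"
      using u v
      by (auto elim!: kite_carrierE
          simp: lg_add_inf_self sup_absorb1 inf_absorb1 inf_absorb2 add.assoc[symmetric])
    show "kite_mult I J lam rho (kite_rdiv I J lam rho (kite_meet I J u v) u) u =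
        kite_meet I J u v"
      using u v
      by (auto elim!: kite_carrierE
          simp: lg_inf_diff_add_self sup_absorb1 inf_absorb1 inf_absorb2 add.assoc)
    show "kite_join I J (kite_ldiv I J lam rho u v) (kite_ldiv I J lam rho v u) =
        Inr (\<lambda>i\<in>I. 0)"
      using u v by (auto elim!: kite_carrierE simp: neg)
    show "kite_join I J (kite_rdiv I J lam rho v u) (kite_rdiv I J lam rho u v) =
        Inr (\<lambda>i\<in>I. 0)"
      using u v by (auto elim!: kite_carrierE simp: neg)
  qed
qed

section \<open>Negations in a kite, and the kites that are good, pseudo MV or Boolean\<close>

context
  fixes G :: "'g::lattice_group_add itself" and I :: "'i set" and J :: "'j set" and lam rho
  assumes data: "kite_data I J lam rho"
begin

private lemma lam: "j \<in> J \<Longrightarrow> lam j \<in> I" "j \<in> J \<Longrightarrow> the_inv_into J lam (lam j) = j"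
  using data by (auto simp: kite_data_def the_inv_into_f_f)

private lemma rho: "j \<in> J \<Longrightarrow> rho j \<in> I" "j \<in> J \<Longrightarrow> the_inv_into J rho (rho j) = j"
  using data by (auto simp: kite_data_def the_inv_into_f_f)

lemma lneg_Inr:
  "lneg (kite G I J lam rho) (Inr x) = Inl (\<lambda>j\<in>J. - x (lam j))"
  by (simp add: lneg_def restrict_eq_iff)

lemma rneg_Inr:
  "rneg (kite G I J lam rho) (Inr x) = Inl (\<lambda>j\<in>J. - x (rho j))"
  by (simp add: rneg_def restrict_eq_iff)

lemma lneg_Inl:
  assumes "\<And>j. j \<in> J \<Longrightarrow> 0 \<le> f j"
  shows "lneg (kite G I J lam rho) (Inl f) =
    Inr (\<lambda>i\<in>I. if i \<in> rho ` J then - f (the_inv_into J rho i) else 0)"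
  using assms rho by (auto simp: lneg_def restrict_eq_iff inf_absorb1 lg_neg_nonpos_iff)

lemma rneg_Inl:
  assumes "\<And>j. j \<in> J \<Longrightarrow> 0 \<le> f j"
  shows "rneg (kite G I J lam rho) (Inl f) =
    Inr (\<lambda>i\<in>I. if i \<in> lam ` J then - f (the_inv_into J lam i) else 0)"
  using assms lam by (auto simp: rneg_def restrict_eq_iff inf_absorb1 lg_neg_nonpos_iff)

text \<open>The inner negation reads the coordinate at \<open>rho j\<close> and the outer one writes
  it back there, so nothing moves, but coordinates outside the image of \<open>rho\<close> are
  erased. In the opposite order, treated next, \<open>lam\<close> takes the place of
  \<open>rho\<close>.\<close>

lemma lneg_rneg_Inr:
  assumes "\<And>i. i \<in> I \<Longrightarrow> x i \<le> 0"
  shows "lneg (kite G I J lam rho) (rneg (kite G I J lam rho) (Inr x)) =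
    Inr (\<lambda>i\<in>I. if i \<in> rho ` J then x i else 0)"
  using assms rho by (auto simp: rneg_Inr lneg_Inl restrict_eq_iff lg_neg_nonneg_iff)

lemma rneg_lneg_Inr:
  assumes "\<And>i. i \<in> I \<Longrightarrow> x i \<le> 0"
  shows "rneg (kite G I J lam rho) (lneg (kite G I J lam rho) (Inr x)) =
    Inr (\<lambda>i\<in>I. if i \<in> lam ` J then x i else 0)"
  using assms lam by (auto simp: lneg_Inr rneg_Inl restrict_eq_iff lg_neg_nonneg_iff)

text \<open>An empty \<open>I\<close> forces \<open>J\<close> to be empty, so in either degenerate
  case each side of the kite is a single point.\<close>

lemma kite_elem_eqI:
  assumes "(\<forall>g::'g. g = 0) \<or> I = {}"
    and "u \<in> kite_carrier I J" "v \<in> kite_carrier I J" "isl u = isl v"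
  shows "u = (v :: ('i, 'j, 'g) kite_elem)"
proof -
  have J: "J = {}" if "I = {}" using that lam by auto
  have "f j = g j" if "j \<in> J" for f g :: "'j \<Rightarrow> 'g" and j
    using assms(1) that J by (metis emptyE)
  then have "f = g" if "f \<in> extensional J" "g \<in> extensional J" for f g :: "'j \<Rightarrow> 'g"
    using that by (blast intro: extensionalityI)
  moreover have "x i = y i" if "i \<in> I" for x y :: "'i \<Rightarrow> 'g" and i
    using assms(1) that by (metis emptyE)
  then have "x = y" if "x \<in> extensional I" "y \<in> extensional I" for x y :: "'i \<Rightarrow> 'g"
    using that by (blast intro: extensionalityI)
  ultimately show ?thesis using assms(2-4) by (elim kite_carrierE) auto
qed

text \<open>Both mixed double negations fix (G^+)^J pointwise, so only (G^-)^I matters. There they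
  erase the coordinates outside the image of \<open>rho\<close> and of \<open>lam\<close>
  respectively, and a constant nonzero sequence reveals whether these images differ.\<close>

lemma kite_good_iff:
  "good_pseudo_bl (kite G I J lam rho) \<longleftrightarrow> (\<forall>g::'g. g = 0) \<or> lam ` J = rho ` J"
proof
  assume good: "good_pseudo_bl (kite G I J lam rho)"
  show "(\<forall>g::'g. g = 0) \<or> lam ` J = rho ` J"
  proof (subst disj_imp, rule impI)
    assume "\<not> (\<forall>g::'g. g = 0)"
    then obtain h :: 'g where h: "h \<le> 0" "h \<noteq> 0"
      using lg_negative_exists by blast
    have "\<forall>i\<in>I. (if i \<in> rho ` J then h else 0) = (if i \<in> lam ` J then h else 0)"
      using good_pseudo_bl.good[OF good, of "Inr (\<lambda>i\<in>I. h)"] h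
      by (simp add: lneg_rneg_Inr rneg_lneg_Inr restrict_eq_iff cong: ball_cong if_cong)
    then have "i \<in> lam ` J \<longleftrightarrow> i \<in> rho ` J" if "i \<in> I" for i
      using that h(2) by (auto split: if_splits)
    then show "lam ` J = rho ` J" using lam(1) rho(1) by blast
  qed
next
  assume *: "(\<forall>g::'g. g = 0) \<or> lam ` J = rho ` J"
  interpret pseudo_bl "kite G I J lam rho" using data by (rule kite_pseudo_bl)
  show "good_pseudo_bl (kite G I J lam rho)"
  proof (unfold_locales, unfold kite_sel)
    fix u :: "('i, 'j, 'g) kite_elem"
    assume "u \<in> kite_carrier I J"
    then show "lneg (kite G I J lam rho) (rneg (kite G I J lam rho) u) =
        rneg (kite G I J lam rho) (lneg (kite G I J lam rho) u)"
    proof (cases rule: kite_carrierE)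
      case (1 f)
      then show ?thesis
        using lam rho by (auto simp: lneg_Inl rneg_Inl lneg_Inr rneg_Inr restrict_eq_iff)
    next
      case (2 x)
      from * show ?thesis
      proof
        assume triv: "\<forall>g::'g. g = 0"
        show ?thesis
          by (rule kite_elem_eqI) (use triv 2 in \<open>auto simp: lneg_rneg_Inr rneg_lneg_Inr\<close>)
      qed (use 2 in \<open>simp add: lneg_rneg_Inr rneg_lneg_Inr\<close>)
    qed
  qed
qed

text \<open>With the least element as one argument, the pseudo MV laws say that the mixed double
  negations are the identity, so neither may erase a coordinate. Conversely, if both maps are onto,
  no quotient is padded and the laws hold coordinate by coordinate.\<close>

lemma kite_pseudo_mv_iff:
  "pseudo_mv (kite G I J lam rho) \<longleftrightarrow> (\<forall>g::'g. g = 0) \<or> lam ` J = I \<and> rho ` J = I"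
proof
  assume mv: "pseudo_mv (kite G I J lam rho)"
  show "(\<forall>g::'g. g = 0) \<or> lam ` J = I \<and> rho ` J = I"
  proof (subst disj_imp, rule impI)
    assume "\<not> (\<forall>g::'g. g = 0)"
    then obtain h :: 'g where h: "h \<le> 0" "h \<noteq> 0"
      using lg_negative_exists by blast
    let ?K = "kite G I J lam rho" and ?x = "\<lambda>i\<in>I. h"
    have "rneg ?K (lneg ?K (Inr ?x)) = Inr ?x"
      using pseudo_mv.rdiv_ldiv_join[OF mv, of "fl_zero ?K" "Inr ?x"] h
      by (simp add: rneg_def lneg_def)
    moreover have "lneg ?K (rneg ?K (Inr ?x)) = Inr ?x"
      using pseudo_mv.rdiv_ldiv_join'[OF mv, of "fl_zero ?K" "Inr ?x"] h
      by (simp add: rneg_def lneg_def)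
    ultimately have "\<forall>i\<in>I. (if i \<in> lam ` J then h else 0) = h"
      "\<forall>i\<in>I. (if i \<in> rho ` J then h else 0) = h"
      using h by (simp_all add: lneg_rneg_Inr rneg_lneg_Inr restrict_eq_iff cong: ball_cong if_cong)
    then have "i \<in> lam ` J \<and> i \<in> rho ` J" if "i \<in> I" for i
      using that h(2) by (auto split: if_splits)
    then show "lam ` J = I \<and> rho ` J = I" using lam(1) rho(1) by blast
  qed
next
  assume *: "(\<forall>g::'g. g = 0) \<or> lam ` J = I \<and> rho ` J = I"
  interpret pseudo_bl "kite G I J lam rho" using data by (rule kite_pseudo_bl)
  show "pseudo_mv (kite G I J lam rho)"
  proof (unfold_locales, unfold kite_sel)
    fix u v :: "('i, 'j, 'g) kite_elem"
    assume uv: "u \<in> kite_carrier I J" "v \<in> kite_carrier I J"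
    show "kite_rdiv I J lam rho u (kite_ldiv I J lam rho v u) = kite_join I J u v"
      using *
    proof
      assume triv: "\<forall>g::'g. g = 0"
      show ?thesis
      proof (rule kite_elem_eqI)
        show "isl (kite_rdiv I J lam rho u (kite_ldiv I J lam rho v u)) = isl (kite_join I J u v)"
          by (cases u; cases v) auto
      qed (use uv triv ldiv_closed rdiv_closed join_closed in auto)
    next
      assume "lam ` J = I \<and> rho ` J = I"
      then have "I = lam ` J" "\<And>i. i \<in> I \<Longrightarrow> i \<in> rho ` J" by auto
      \<comment> \<open>For \<open>u\<close> in (G^+)^J and \<open>v\<close> in (G^-)^I: the two
        divisions give back \<open>v\<close>.\<close>
      moreover have "a - (- b + a) = b" for a b :: 'g
        by (simp only: diff_conv_add_uminus minus_add minus_minus add.assoc[symmetric]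
            right_minus add_0_left)
      ultimately show ?thesis using uv lam rho
        by (auto elim!: kite_carrierE simp: restrict_eq_iff restrict_eq_extensional_iff
            lg_diff_inf_self sup_commute inf_absorb1)
    qed
    show "kite_ldiv I J lam rho (kite_rdiv I J lam rho u v) u = kite_join I J u v"
      using *
    proof
      assume triv: "\<forall>g::'g. g = 0"
      show ?thesis
      proof (rule kite_elem_eqI)
        show "isl (kite_ldiv I J lam rho (kite_rdiv I J lam rho u v) u) = isl (kite_join I J u v)"
          by (cases u; cases v) auto
      qed (use uv triv ldiv_closed rdiv_closed join_closed in auto)
    next
      assume "lam ` J = I \<and> rho ` J = I"
      then have "I = rho ` J" "\<And>i. i \<in> I \<Longrightarrow> i \<in> lam ` J" by auto
      then show ?thesis using uv lam rho
        by (auto elim!: kite_carrierE simp: restrict_eq_iff restrict_eq_extensional_iff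
            lg_neg_inf_add_self sup_commute inf_absorb1)
    qed
  qed
qed

text \<open>The images of 0 and 1 exhaust \<open>bool\<close>, so injectivity forces a constant
  sequence in (G^-)^I to equal 1. Conversely, the map telling the two sides of the kite apart is
  always a homomorphism, and it is injective in the degenerate cases.\<close>

lemma kite_isomorphic_bool_iff:
  "fl_isomorphic (kite G I J lam rho) bool_fl \<longleftrightarrow> (\<forall>g::'g. g = 0) \<or> I = {}"
proof
  assume "fl_isomorphic (kite G I J lam rho) bool_fl"
  then obtain h where hom: "h \<in> fl_hom (kite G I J lam rho) bool_fl"
    and inj: "inj_on h (kite_carrier I J)"
    unfolding fl_isomorphic_def fl_iso_def bij_betw_def by auto
  have h01: "h (Inr (\<lambda>i\<in>I. 0))" "\<not> h (Inl (\<lambda>j\<in>J. 0))"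
    using hom by (simp_all add: fl_hom_def bool_fl_def)
  show "(\<forall>g::'g. g = 0) \<or> I = {}"
  proof (subst disj_imp, rule impI)
    assume "\<not> (\<forall>g::'g. g = 0)"
    then obtain a :: 'g where a: "a \<le> 0" "a \<noteq> 0"
      using lg_negative_exists by blast
    have "h (Inr (\<lambda>i\<in>I. a)) = h (Inr (\<lambda>i\<in>I. 0)) \<or> h (Inr (\<lambda>i\<in>I. a)) = h (Inl (\<lambda>j\<in>J. 0))"
      using h01 by auto
    then have "Inr (\<lambda>i\<in>I. a) = (Inr (\<lambda>i\<in>I. 0) :: ('i, 'j, 'g) kite_elem)"
      using inj_onD[OF inj, of "Inr (\<lambda>i\<in>I. a)" "Inr (\<lambda>i\<in>I. 0)"]
        inj_onD[OF inj, of "Inr (\<lambda>i\<in>I. a)" "Inl (\<lambda>j\<in>J. 0)"] a by auto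
    then show "I = {}" using a by (auto simp: restrict_eq_iff)
  qed
next
  assume *: "(\<forall>g::'g. g = 0) \<or> I = {}"
  have "inj_on (\<lambda>u. \<not> isl u) (kite_carrier I J :: ('i, 'j, 'g) kite_elem set)"
    by (intro inj_onI kite_elem_eqI *) auto
  moreover have "(\<lambda>u. \<not> isl u) ` (kite_carrier I J :: ('i, 'j, 'g) kite_elem set) = UNIV"
  proof -
    have "b \<in> (\<lambda>u. \<not> isl u) ` (kite_carrier I J :: ('i, 'j, 'g) kite_elem set)" for b
      by (rule image_eqI[where x = "if b then Inr (\<lambda>i\<in>I. 0) else Inl (\<lambda>j\<in>J. 0)"]) auto
    then show ?thesis by blast
  qed
  moreover have "(\<lambda>u. \<not> isl u) \<in> fl_hom (kite G I J lam rho) bool_fl"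
    by (auto simp: fl_hom_def bool_fl_def elim!: kite_carrierE)
  ultimately show "fl_isomorphic (kite G I J lam rho) bool_fl"
    by (auto simp: fl_isomorphic_def fl_iso_def bij_betw_def bool_fl_def)
qed

end

section \<open>Maps between kites induced by reindexing\<close>

text \<open>Contravariant in the indices: \<open>\<sigma>\<close> and \<open>\<tau>\<close> lead
  from the new index sets to the old ones. Inclusions give the projections onto parts of a kite,
  bijections compatible with the edges give isomorphisms.\<close>

definition kite_pullback :: "'k set \<Rightarrow> 'l set \<Rightarrow> ('k \<Rightarrow> 'i) \<Rightarrow> ('l \<Rightarrow> 'j)
    \<Rightarrow> ('i, 'j, 'g) kite_elem \<Rightarrow> ('k, 'l, 'g) kite_elem" where
  "kite_pullback I' J' \<sigma> \<tau> = map_sum (\<lambda>f. restrict (f \<circ> \<tau>) J') (\<lambda>x. restrict (x \<circ> \<sigma>) I')"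

lemma kite_pullback_simps [simp]:
  "kite_pullback I' J' \<sigma> \<tau> (Inl f) = Inl (\<lambda>j\<in>J'. f (\<tau> j))"
  "kite_pullback I' J' \<sigma> \<tau> (Inr x) = Inr (\<lambda>i\<in>I'. x (\<sigma> i))"
  by (simp_all add: kite_pullback_def comp_def)

text \<open>Commutation with \<open>lam\<close> and \<open>rho\<close> takes care of the products.
  The divisions inside (G^+)^J also test whether an index lies in the image of \<open>lam\<close> or
  \<open>rho\<close>; \<open>refl\<close>, together with commutation, makes these tests agree in
  both kites.\<close>

lemma kite_pullback_hom:
  fixes G :: "'g::lattice_group_add itself" and I :: "'i set" and J :: "'j set"
    and I' :: "'k set" and J' :: "'l set"
  assumes data: "kite_data I J lam rho" "kite_data I' J' lam' rho'"
    and map: "\<sigma> ` I' \<subseteq> I" "\<tau> ` J' \<subseteq> J"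
    and comm: "\<And>j. j \<in> J' \<Longrightarrow> lam (\<tau> j) = \<sigma> (lam' j)" "\<And>j. j \<in> J' \<Longrightarrow> rho (\<tau> j) = \<sigma> (rho' j)"
    and refl: "\<And>i. i \<in> I' \<Longrightarrow> \<sigma> i \<in> lam ` J \<Longrightarrow> i \<in> lam' ` J'"
      "\<And>i. i \<in> I' \<Longrightarrow> \<sigma> i \<in> rho ` J \<Longrightarrow> i \<in> rho' ` J'"
  shows "kite_pullback I' J' \<sigma> \<tau> \<in> fl_hom (kite G I J lam rho) (kite G I' J' lam' rho')"
proof -
  have \<sigma>: "\<sigma> i \<in> I" if "i \<in> I'" for i using map that by auto
  have \<tau>: "\<tau> j \<in> J" if "j \<in> J'" for j using map that by auto
  have inv: "the_inv_into J' lam' (lam' j) = j" "the_inv_into J lam (\<sigma> (lam' j)) = \<tau> j"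
    "the_inv_into J' rho' (rho' j) = j" "the_inv_into J rho (\<sigma> (rho' j)) = \<tau> j"
    "\<sigma> (lam' j) \<in> lam ` J" "\<sigma> (rho' j) \<in> rho ` J" "lam' j \<in> I'" "rho' j \<in> I'"
    if "j \<in> J'" for j
    using data \<tau>[OF that] that
    by (auto simp: kite_data_def the_inv_into_f_f comm[OF that, symmetric])
  have mem: "\<sigma> i \<in> lam ` J \<longleftrightarrow> i \<in> lam' ` J'" "\<sigma> i \<in> rho ` J \<longleftrightarrow> i \<in> rho' ` J'"
    if "i \<in> I'" for i
    using refl[OF that] inv by auto
  have inv': "the_inv_into J lam (\<sigma> i) = \<tau> (the_inv_into J' lam' i)" if "i \<in> lam' ` J'" for i
    using that inv by auto
  have inv'': "the_inv_into J rho (\<sigma> i) = \<tau> (the_inv_into J' rho' i)" if "i \<in> rho' ` J'" for i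
    using that inv by auto
  show ?thesis
    unfolding fl_hom_def kite_sel
  proof (intro CollectI conjI ballI Pi_I)
    fix u v :: "('i, 'j, 'g) kite_elem"
    assume u: "u \<in> kite_carrier I J"
    show "kite_pullback I' J' \<sigma> \<tau> u \<in> kite_carrier I' J'"
      using u \<sigma> \<tau> by (auto elim!: kite_carrierE)
    assume v: "v \<in> kite_carrier I J"
    note * = restrict_eq_iff \<sigma> \<tau> inv comm mem inv' inv''
    show "kite_pullback I' J' \<sigma> \<tau> (kite_mult I J lam rho u v) =
        kite_mult I' J' lam' rho' (kite_pullback I' J' \<sigma> \<tau> u) (kite_pullback I' J' \<sigma> \<tau> v)"
      by (cases u; cases v) (auto simp: *)
    show "kite_pullback I' J' \<sigma> \<tau> (kite_meet I J u v) =
        kite_meet I' J' (kite_pullback I' J' \<sigma> \<tau> u) (kite_pullback I' J' \<sigma> \<tau> v)"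
      by (cases u; cases v) (auto simp: *)
    show "kite_pullback I' J' \<sigma> \<tau> (kite_join I J u v) =
        kite_join I' J' (kite_pullback I' J' \<sigma> \<tau> u) (kite_pullback I' J' \<sigma> \<tau> v)"
      by (cases u; cases v) (auto simp: *)
    show "kite_pullback I' J' \<sigma> \<tau> (kite_ldiv I J lam rho u v) =
        kite_ldiv I' J' lam' rho' (kite_pullback I' J' \<sigma> \<tau> u) (kite_pullback I' J' \<sigma> \<tau> v)"
      by (cases u; cases v) (auto simp: *)
    show "kite_pullback I' J' \<sigma> \<tau> (kite_rdiv I J lam rho u v) =
        kite_rdiv I' J' lam' rho' (kite_pullback I' J' \<sigma> \<tau> u) (kite_pullback I' J' \<sigma> \<tau> v)"
      by (cases u; cases v) (auto simp: *)
  qed (auto simp: restrict_eq_iff \<sigma> \<tau>)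
qed

text \<open>By injectivity a sequence can be transported to the images of \<open>\<sigma>\<close>
  and \<open>\<tau>\<close>; extending it by 0 elsewhere respects both sign conditions.\<close>

lemma kite_pullback_image:
  assumes "\<sigma> ` I' \<subseteq> I" "\<tau> ` J' \<subseteq> J" "inj_on \<sigma> I'" "inj_on \<tau> J'"
  shows "kite_pullback I' J' \<sigma> \<tau> ` kite_carrier I J =
    (kite_carrier I' J' :: ('k, 'l, 'g::lattice_group_add) kite_elem set)"
proof (intro equalityI subsetI)
  fix v :: "('k, 'l, 'g) kite_elem"
  assume "v \<in> kite_pullback I' J' \<sigma> \<tau> ` kite_carrier I J"
  then show "v \<in> kite_carrier I' J'" using assms(1,2) by (auto elim!: kite_carrierE simp: image_subset_iff)
next
  fix v :: "('k, 'l, 'g) kite_elem" assume "v \<in> kite_carrier I' J'"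
  then show "v \<in> kite_pullback I' J' \<sigma> \<tau> ` kite_carrier I J"
  proof (cases rule: kite_carrierE)
    case (1 f)
    with assms show ?thesis
      by (intro image_eqI[of _ _
            "Inl (\<lambda>j\<in>J. if j \<in> \<tau> ` J' then f (the_inv_into J' \<tau> j) else 0)"])
        (auto simp: the_inv_into_f_f restrict_eq_extensional_iff)
  next
    case (2 x)
    with assms show ?thesis
      by (intro image_eqI[of _ _
            "Inr (\<lambda>i\<in>I. if i \<in> \<sigma> ` I' then x (the_inv_into I' \<sigma> i) else 0)"])
        (auto simp: the_inv_into_f_f restrict_eq_extensional_iff)
  qed
qed

text \<open>Only the set of edges matters, not its indexing by \<open>J\<close>. Since
  \<open>lam\<close> is injective, an edge is determined by its source, so a bijection of vertices
  that matches the edges induces a bijection \<open>\<tau>\<close> of the edge indices.\<close>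

lemma kite_isomorphicI:
  fixes G :: "'g::lattice_group_add itself" and I :: "'i set" and J :: "'j set"
    and I' :: "'k set" and J' :: "'l set"
  assumes data: "kite_data I J lam rho" "kite_data I' J' lam' rho'"
    and \<sigma>: "bij_betw \<sigma> I' I"
    and R: "(\<lambda>j. (lam j, rho j)) ` J = (\<lambda>j. (\<sigma> (lam' j), \<sigma> (rho' j))) ` J'"
  shows "fl_isomorphic (kite G I J lam rho) (kite G I' J' lam' rho')"
proof -
  have lr: "lam' j \<in> I'" "rho' j \<in> I'" if "j \<in> J'" for j
    using that data by (auto simp: kite_data_def)
  have \<sigma>_inj: "\<sigma> a = \<sigma> b \<longleftrightarrow> a = b" if "a \<in> I'" "b \<in> I'" for a b
    using \<sigma> that by (auto simp: bij_betw_def inj_on_def)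
  have "\<exists>k\<in>J. lam k = \<sigma> (lam' j) \<and> rho k = \<sigma> (rho' j)" if "j \<in> J'" for j
  proof -
    have "(\<sigma> (lam' j), \<sigma> (rho' j)) \<in> (\<lambda>j. (lam j, rho j)) ` J" unfolding R using that by blast
    then show ?thesis by auto
  qed
  then obtain \<tau> where \<tau>: "\<And>j. j \<in> J' \<Longrightarrow> \<tau> j \<in> J \<and> lam (\<tau> j) = \<sigma> (lam' j) \<and> rho (\<tau> j) = \<sigma> (rho' j)"
    by metis
  have ex: "\<exists>j\<in>J'. lam k = \<sigma> (lam' j) \<and> rho k = \<sigma> (rho' j)" if "k \<in> J" for k
  proof -
    have "(lam k, rho k) \<in> (\<lambda>j. (\<sigma> (lam' j), \<sigma> (rho' j))) ` J'" unfolding R[symmetric] using that by blast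
    then show ?thesis by auto
  qed
  have \<tau>_onto: "\<exists>j\<in>J'. k = \<tau> j" if "k \<in> J" for k
    using ex[OF that] \<tau> data(1) that unfolding kite_data_def inj_on_def by metis
  have \<tau>_inj: "inj_on \<tau> J'"
    using \<tau> data(2) lr \<sigma>_inj unfolding kite_data_def inj_on_def by metis
  have hom: "kite_pullback I' J' \<sigma> \<tau> \<in> fl_hom (kite G I J lam rho) (kite G I' J' lam' rho')"
  proof (rule kite_pullback_hom[OF data])
    show "\<sigma> ` I' \<subseteq> I" "\<tau> ` J' \<subseteq> J" using \<sigma> \<tau> by (auto simp: bij_betw_def)
    fix i assume i: "i \<in> I'"
    show "i \<in> lam' ` J'" if "\<sigma> i \<in> lam ` J" using that ex i \<sigma>_inj lr by force
    show "i \<in> rho' ` J'" if "\<sigma> i \<in> rho ` J" using that ex i \<sigma>_inj lr by force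
  qed (use \<tau> in auto)
  have I: "\<exists>i'\<in>I'. i = \<sigma> i'" if "i \<in> I" for i using \<sigma> that by (auto simp: bij_betw_def)
  have "inj_on (kite_pullback I' J' \<sigma> \<tau>) (kite_carrier I J :: ('i, 'j, 'g) kite_elem set)"
  proof (rule inj_onI)
    fix u v :: "('i, 'j, 'g) kite_elem"
    assume uv: "u \<in> kite_carrier I J" "v \<in> kite_carrier I J"
      and eq: "kite_pullback I' J' \<sigma> \<tau> u = kite_pullback I' J' \<sigma> \<tau> v"
    have "f = g" if "f \<in> extensional J" "g \<in> extensional J" "\<forall>j\<in>J'. f (\<tau> j) = g (\<tau> j)"
      for f g :: "'j \<Rightarrow> 'g"
      using that \<tau>_onto by (metis extensionalityI)
    moreover have "x = y" if "x \<in> extensional I" "y \<in> extensional I" "\<forall>i\<in>I'. x (\<sigma> i) = y (\<sigma> i)"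
      for x y :: "'i \<Rightarrow> 'g"
      using that I by (metis extensionalityI)
    ultimately show "u = v" using uv eq by (auto elim!: kite_carrierE simp: restrict_eq_iff)
  qed
  moreover have "kite_pullback I' J' \<sigma> \<tau> ` kite_carrier I J =
      (kite_carrier I' J' :: ('k, 'l, 'g) kite_elem set)" 
    by (rule kite_pullback_image) (use \<sigma> \<tau> \<tau>_inj in \<open>auto simp: bij_betw_def\<close>)
  ultimately show ?thesis
    using hom unfolding fl_isomorphic_def fl_iso_def bij_betw_def by auto
qed

text \<open>Connectedness is phrased through sets \<open>X\<close> that no edge enters or leaves.
  The classification of graphs can then take for \<open>X\<close> the set of vertices visited by a
  walk.\<close>

lemma kite_SI_connected:
  fixes G :: "'g::lattice_group_add itself" and g :: 'g and I :: "'i set" and J :: "'j set"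
  assumes data: "kite_data I J lam rho" and SI: "subdirectly_irreducible (kite G I J lam rho)"
    and g: "g \<noteq> 0" and X: "X \<subseteq> I" "X \<noteq> {}"
    and closed: "\<And>j. j \<in> J \<Longrightarrow> lam j \<in> X \<longleftrightarrow> rho j \<in> X"
  shows "X = I"
proof (rule ccontr)
  assume "X \<noteq> I"
  obtain h where h: "h \<le> 0" "h \<noteq> (0::'g)" using g by (rule lg_negative_exists)
  \<comment> \<open>\<open>True\<close> selects \<open>X\<close> and \<open>False\<close> its
    complement. As no edge crosses between them, \<open>J' k\<close> can be described by sources or
    by targets alike, and each part carries a kite.\<close>
  define I' where "I' k = (if k then X else I - X)" for k
  define J' where "J' k = {j \<in> J. lam j \<in> I' k}" for k
  have I': "I' k \<subseteq> I" "I' k \<noteq> {}" for k using X \<open>X \<noteq> I\<close> by (auto simp: I'_def)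
  have lr: "lam j \<in> I" "rho j \<in> I" if "j \<in> J" for j
    using that data by (auto simp: kite_data_def)
  have J': "j \<in> J' k \<longleftrightarrow> j \<in> J \<and> lam j \<in> I' k" "j \<in> J' k \<longleftrightarrow> j \<in> J \<and> rho j \<in> I' k" for j k
    using closed lr by (auto simp: J'_def I'_def)
  have J'_sub: "J' k \<subseteq> J" for k by (auto simp: J'_def)
  have data': "kite_data (I' k) (J' k) lam rho" for k
    using data J' unfolding kite_data_def Pi_iff inj_on_def by blast
  define p :: "bool \<Rightarrow> ('i, 'j, 'g) kite_elem \<Rightarrow> ('i, 'j, 'g) kite_elem"
    where "p k = kite_pullback (I' k) (J' k) (\<lambda>i. i) (\<lambda>j. j)" for k
  have hom: "p k \<in> fl_hom (kite G I J lam rho) (kite G (I' k) (J' k) lam rho)" for k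
    unfolding p_def
    by (rule kite_pullback_hom[OF data data']) (use I'[of k] J'[of _ k] in auto)
  have onto: "p k ` carrier (kite G I J lam rho) = carrier (kite G (I' k) (J' k) lam rho)"
    for k
    unfolding p_def kite_sel by (rule kite_pullback_image) (use I' J'_sub in auto)
  have "subdirect_embedding (kite G I J lam rho) UNIV (\<lambda>k. kite G (I' k) (J' k) lam rho) p"
    unfolding subdirect_embedding_def
  proof (intro conjI ballI impI)
    fix u v assume uv: "u \<in> carrier (kite G I J lam rho)" "v \<in> carrier (kite G I J lam rho)"
      and eq: "\<forall>k\<in>UNIV. p k u = p k v"
    have cover: "i \<in> I \<Longrightarrow> \<exists>k. i \<in> I' k" "j \<in> J \<Longrightarrow> \<exists>k. j \<in> J' k" for i j
      using lr by (auto simp: I'_def J')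
    have "f = f'" if "f \<in> extensional J" "f' \<in> extensional J" "\<forall>k. \<forall>j\<in>J' k. f j = f' j"
      for f f' :: "'j \<Rightarrow> 'g"
      using that cover(2) by (metis extensionalityI)
    moreover have "x = x'"
      if "x \<in> extensional I" "x' \<in> extensional I" "\<forall>k. \<forall>i\<in>I' k. x i = x' i"
      for x x' :: "'i \<Rightarrow> 'g"
      using that cover(1) by (metis extensionalityI)
    ultimately show "u = v" using uv eq
      by (auto simp: p_def restrict_eq_iff elim!: kite_carrierE)
  qed (use hom onto in auto)
  then obtain k where "p k \<in> fl_iso (kite G I J lam rho) (kite G (I' k) (J' k) lam rho)"
    using subdirectly_irreducibleD[OF SI] by blast
  then have inj: "inj_on (p k) (kite_carrier I J)"
    by (simp add: fl_iso_def bij_betw_def)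
  \<comment> \<open>This sequence vanishes on the part kept by \<open>p k\<close> and so projects to
    1. On the other part, which is nonempty, it has the value \<open>h\<close> and differs from
    1.\<close>
  define x where "x = (\<lambda>i\<in>I. if i \<in> I' k then 0 else h)"
  have "p k (Inr x) = p k (Inr (\<lambda>i\<in>I. 0))"
    using I' by (auto simp: p_def restrict_eq_iff x_def)
  then have "x = (\<lambda>i\<in>I. 0)"
    using inj_onD[OF inj, of "Inr x" "Inr (\<lambda>i\<in>I. 0)"] h by (auto simp: x_def)
  moreover obtain i where "i \<in> I" "i \<notin> I' k"
    using I'[of "\<not> k"] by (auto simp: I'_def split: if_splits)
  ultimately show False using h by (auto simp: x_def restrict_eq_iff)
qed

section \<open>Connected graphs with degrees at most one\<close>

text \<open>Follow the unique successors from a vertex that has no predecessor. The visited vertices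
  are closed under edges in both directions, hence they are all of \<open>I\<close>, and the two
  cases tell whether the walk stops.\<close>

lemma single_valued_path_cases:
  fixes R :: "('i \<times> 'i) set"
  assumes R: "R \<subseteq> I \<times> I" "single_valued R" "single_valued (R\<inverse>)"
    and conn: "\<And>X. X \<subseteq> I \<Longrightarrow> X \<noteq> {} \<Longrightarrow> (\<And>a b. (a, b) \<in> R \<Longrightarrow> a \<in> X \<longleftrightarrow> b \<in> X) \<Longrightarrow> X = I"
    and i0: "i0 \<in> I" "i0 \<notin> Range R"
  obtains (infinite) \<sigma> :: "nat \<Rightarrow> 'i"
    where "bij_betw \<sigma> UNIV I" "R = (\<lambda>k. (\<sigma> k, \<sigma> (k + 1))) ` UNIV"
  | (finite) \<sigma> :: "nat \<Rightarrow> 'i" and n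
    where "bij_betw \<sigma> {..<n + 1} I" "R = (\<lambda>k. (\<sigma> k, \<sigma> (k + 1))) ` {..<n}"
proof -
  define s where "s a = (SOME b. (a, b) \<in> R)" for a
  have s: "(a, s a) \<in> R" if "a \<in> Domain R" for a
    using that unfolding s_def by (auto intro: someI)
  define \<sigma> where "\<sigma> k = (s ^^ k) i0" for k
  have step: "\<sigma> (Suc k) = s (\<sigma> k)" "\<sigma> 0 = i0" for k by (simp_all add: \<sigma>_def)
  \<comment> \<open>The values of \<open>s\<close> outside \<open>Domain R\<close> are arbitrary.
    \<open>N\<close> is the initial segment of step numbers reached along genuine edges; the vertex
    at its end, if there is one, need not have a successor.\<close>
  define N where "N = {k. \<forall>m<k. \<sigma> m \<in> Domain R}"
  have N: "k \<in> N" "\<sigma> k \<in> Domain R" "(\<sigma> k, \<sigma> (Suc k)) \<in> R" if "Suc k \<in> N" for k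
    using that s by (auto simp: N_def step)
  have N0: "0 \<in> N" by (simp add: N_def)
  \<comment> \<open>Used to extend the walk whenever its current vertex still has a
    successor.\<close>
  have Suc_N: "Suc k \<in> N" if "k \<in> N" "\<sigma> k \<in> Domain R" for k
    using that by (auto simp: N_def less_Suc_eq)
  \<comment> \<open>Unique predecessors let both walks be cut back step by step; if one reached
    \<open>i0\<close> before the other, \<open>i0\<close> would have a predecessor.\<close>
  have inj: "k = l" if "k \<in> N" "l \<in> N" "\<sigma> k = \<sigma> l" for k l
    using that
  proof (induction k arbitrary: l)
    case 0
    then show ?case using i0(2) N(3) step(2) by (cases l) (simp, metis RangeI)
  next
    case (Suc k)
    show ?case
    proof (cases l)
      case 0
      then show ?thesis using Suc.prems i0(2) N(3) step(2) by (metis RangeI)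
    next
      case (Suc l')
      then have "\<sigma> k = \<sigma> l'"
        using N(3)[of k] N(3)[of l'] Suc.prems R(3) by (auto simp: single_valued_def)
      then show ?thesis using Suc.IH[of l'] N(1) Suc Suc.prems by auto
    qed
  qed
  have onto: "\<sigma> ` N = I"
  proof (rule conn)
    show "\<sigma> ` N \<subseteq> I"
    proof safe
      fix k assume "k \<in> N"
      then show "\<sigma> k \<in> I" using i0(1) N(3) R(1) step(2) by (cases k) auto
    qed
    show "\<sigma> ` N \<noteq> {}" using N0 by blast
    fix a b assume ab: "(a, b) \<in> R"
    show "a \<in> \<sigma> ` N \<longleftrightarrow> b \<in> \<sigma> ` N"
    proof
      assume "a \<in> \<sigma> ` N"
      then obtain k where k: "k \<in> N" "a = \<sigma> k" by blast
      then have "Suc k \<in> N" using Suc_N ab by auto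
      moreover have "b = \<sigma> (Suc k)"
        using N(3)[OF calculation] ab k R(2) by (auto simp: single_valued_def)
      ultimately show "b \<in> \<sigma> ` N" by blast
    next
      assume "b \<in> \<sigma> ` N"
      then obtain k where k: "k \<in> N" "b = \<sigma> k" by blast
      then obtain l where l: "k = Suc l" using ab i0(2) step(2) by (cases k) auto
      then have "a = \<sigma> l"
        using N(3)[of l] ab k R(3) by (auto simp: single_valued_def)
      then show "a \<in> \<sigma> ` N" using N(1) k l by blast
    qed
  qed
  have bij: "bij_betw \<sigma> N I" using inj onto by (auto simp: bij_betw_def inj_on_def)
  have edges: "R = (\<lambda>k. (\<sigma> k, \<sigma> (k + 1))) ` {k. Suc k \<in> N}"
  proof (intro equalityI subsetI)
    fix e assume "e \<in> R"
    then obtain a b where e: "e = (a, b)" "(a, b) \<in> R" by (cases e) auto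
    then obtain k where k: "k \<in> N" "a = \<sigma> k" using onto R(1) by blast
    then have "Suc k \<in> N" using Suc_N e by auto
    moreover have "b = \<sigma> (Suc k)"
      using N(3)[OF calculation] e k R(2) by (auto simp: single_valued_def)
    ultimately show "e \<in> (\<lambda>k. (\<sigma> k, \<sigma> (k + 1))) ` {k. Suc k \<in> N}" using e k by auto
  qed (use N(3) in auto)
  show thesis
  proof (cases "\<forall>k. \<sigma> k \<in> Domain R")
    case True
    then have "N = UNIV" by (auto simp: N_def)
    then show thesis using infinite[of \<sigma>] bij edges by simp
  next
    case False
    \<comment> \<open>\<open>\<sigma> n\<close> is the last vertex, so the path has
      \<open>n + 1\<close> vertices and \<open>n\<close> edges; \<open>n = 0\<close> is a single
      vertex without edges.\<close>
    define n where "n = (LEAST k. \<sigma> k \<notin> Domain R)"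
    have n: "\<sigma> n \<notin> Domain R" "m < n \<Longrightarrow> \<sigma> m \<in> Domain R" for m
      using False LeastI_ex[of "\<lambda>k. \<sigma> k \<notin> Domain R"] not_less_Least unfolding n_def by blast+
    have "N = {..<n + 1}"
    proof (intro equalityI subsetI)
      fix k assume "k \<in> N"
      then show "k \<in> {..<n + 1}" using n(1) by (cases "n < k") (auto simp: N_def)
    qed (use n(2) in \<open>auto simp: N_def\<close>)
    moreover from this have "{k. Suc k \<in> N} = {..<n}" by auto
    ultimately show thesis using finite[of \<sigma> n] bij edges by simp
  qed
qed

text \<open>Here successor and predecessor are inverse bijections, so the walk from
  \<open>i0\<close> is indexed by all integers and covers \<open>I\<close>. Either it is injective,
  or it is periodic and its least period is the length of a cycle.\<close>

lemma single_valued_cycle_cases: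
  fixes R :: "('i \<times> 'i) set"
  assumes R: "single_valued R" "single_valued (R\<inverse>)" "Domain R = I" "Range R = I"
    and conn: "\<And>X. X \<subseteq> I \<Longrightarrow> X \<noteq> {} \<Longrightarrow> (\<And>a b. (a, b) \<in> R \<Longrightarrow> a \<in> X \<longleftrightarrow> b \<in> X) \<Longrightarrow> X = I"
    and i0: "i0 \<in> I"
  obtains (infinite) \<sigma> :: "int \<Rightarrow> 'i"
    where "bij_betw \<sigma> UNIV I" "R = (\<lambda>k. (\<sigma> k, \<sigma> (k + 1))) ` UNIV"
  | (finite) \<sigma> :: "nat \<Rightarrow> 'i" and n
    where "n > 0" "bij_betw \<sigma> {..<n} I" "R = (\<lambda>k. (\<sigma> k, \<sigma> ((k + 1) mod n))) ` {..<n}"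
proof -
  define s where "s a = (SOME b. (a, b) \<in> R)" for a
  define t where "t b = (SOME a. (a, b) \<in> R)" for b
  have s: "(a, s a) \<in> R" and t: "(t a, a) \<in> R" if "a \<in> I" for a
    using that R(3,4) unfolding s_def t_def by (auto intro: someI)
  have sI: "s a \<in> I" and tI: "t a \<in> I" if "a \<in> I" for a
    using s[OF that] t[OF that] R(3,4) by auto
  have st: "s (t a) = a" and ts: "t (s a) = a" if "a \<in> I" for a
    using s[OF that] t[OF that] s[OF tI[OF that]] t[OF sI[OF that]] R(1,2)
    by (auto simp: single_valued_def)
  have R_iff: "(a, b) \<in> R \<longleftrightarrow> a \<in> I \<and> b = s a" for a b
    using s R(1,3) by (auto simp: single_valued_def)
  \<comment> \<open>At most one exponent is nonzero, because \<open>nat\<close> sends negative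
    integers to 0: forward steps for positive \<open>k\<close>, backward steps for negative
    \<open>k\<close>.\<close>
  define \<sigma> :: "int \<Rightarrow> 'i" where "\<sigma> k = (s ^^ nat k) ((t ^^ nat (- k)) i0)" for k
  have powI: "(s ^^ m) a \<in> I" "(t ^^ m) a \<in> I" if "a \<in> I" for a m
    using that by (induction m) (auto simp: sI tI)
  then have \<sigma>I: "\<sigma> k \<in> I" for k using i0 by (simp add: \<sigma>_def)
  have step: "\<sigma> (k + 1) = s (\<sigma> k)" for k
  proof (cases "k \<ge> 0")
    case True
    then show ?thesis by (simp add: \<sigma>_def nat_add_distrib)
  next
    case False
    then have "nat (- k) = Suc (nat (- (k + 1)))" by simp
    then have "\<sigma> k = t (\<sigma> (k + 1))" using False by (simp add: \<sigma>_def)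
    then show ?thesis using st \<sigma>I by simp
  qed
  have onto: "range \<sigma> = I"
  proof (rule conn)
    fix a b assume ab: "(a, b) \<in> R"
    then have b: "b = s a" "a \<in> I" by (auto simp: R_iff)
    show "a \<in> range \<sigma> \<longleftrightarrow> b \<in> range \<sigma>"
    proof
      assume "b \<in> range \<sigma>"
      then obtain k where "b = \<sigma> (k - 1 + 1)" by auto
      then have "s a = s (\<sigma> (k - 1))" using b by (simp only: step)
      then have "a = \<sigma> (k - 1)" using ts \<sigma>I b by metis
      then show "a \<in> range \<sigma>" by blast
    qed (use b step in \<open>metis rangeE rangeI\<close>)
  qed (use \<sigma>I in auto)
  have edges: "R = (\<lambda>k. (\<sigma> k, \<sigma> (k + 1))) ` UNIV"
    using onto by (auto simp: R_iff step image_iff \<sigma>I)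
  \<comment> \<open>Steps are invertible, so coincidences of the walk are invariant under
    translation. Any repetition therefore yields a period at 0.\<close>
  have shift: "\<sigma> (a + int m) = \<sigma> (b + int m) \<longleftrightarrow> \<sigma> a = \<sigma> b" for a b m
  proof (induction m)
    case (Suc m)
    have "\<sigma> (a + int (Suc m)) = s (\<sigma> (a + int m))" "\<sigma> (b + int (Suc m)) = s (\<sigma> (b + int m))"
      by (simp_all only: step[symmetric]) (simp_all add: ac_simps)
    then show ?case using Suc ts \<sigma>I by metis
  qed simp
  show thesis
  proof (cases "inj \<sigma>")
    case True
    then show thesis using infinite[of \<sigma>] onto edges by (simp add: bij_betw_def)
  next
    case False
    define P where "P n \<longleftrightarrow> n > 0 \<and> \<sigma> (int n) = \<sigma> 0" for n
    have period: "P (nat (b - a))" if "a < b" "\<sigma> a = \<sigma> b" for a b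
    proof -
      have "\<sigma> (b - a) = \<sigma> 0"
      proof (cases "a \<ge> 0")
        case True
        then show ?thesis using shift[of 0 "nat a" "b - a"] that by simp
      next
        case False
        then show ?thesis using shift[of a "nat (- a)" b] that by simp
      qed
      then show ?thesis using that by (simp add: P_def)
    qed
    obtain a b where "a < b" "\<sigma> a = \<sigma> b"
      using False by (metis inj_def linorder_neqE)
    then have "\<exists>n. P n" using period by blast
    then obtain n where n: "P n" "\<And>m. P m \<Longrightarrow> n \<le> m"
      using LeastI_ex[of P] Least_le[of P] by blast
    have n0: "n > 0" "\<sigma> (int n) = \<sigma> 0" using n(1) by (auto simp: P_def)
    have per1: "\<sigma> (k + int n) = \<sigma> k" for k
    proof (cases "k \<ge> 0")
      case True
      then show ?thesis using shift[of "int n" "nat k" 0] n0(2) by (simp add: add.commute)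
    next
      case False
      then show ?thesis using shift[of "k + int n" "nat (- k)" k] n0(2) by simp
    qed
    have per: "\<sigma> (k + int m * int n) = \<sigma> k" for k m
    proof (induction m)
      case (Suc m)
      then show ?case using per1[of "k + int m * int n"] by (simp add: algebra_simps)
    qed simp
    \<comment> \<open>\<open>per\<close> only adds nonnegative multiples of \<open>n\<close>, so the
      sign of the quotient decides from which side it is applied.\<close>
    have per_mod: "\<sigma> (k mod int n) = \<sigma> k" for k
    proof (cases "k div int n \<ge> 0")
      case True
      then show ?thesis using per[of "k mod int n" "nat (k div int n)"] by simp
    next
      case False
      then have "k + int (nat (- (k div int n))) * int n = k mod int n"
        by (simp add: minus_div_mult_eq_mod)
      then show ?thesis using per[of k] by metis
    qed
    have "\<exists>m<n. \<sigma> k = \<sigma> (int m)" for k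
      using per_mod[of k] n0(1) by (intro exI[of _ "nat (k mod int n)"]) (simp add: nat_less_iff)
    then have "(\<lambda>k. \<sigma> (int k)) ` {..<n} = I" using onto by force
    \<comment> \<open>A coincidence among the first \<open>n\<close> vertices would produce a period
      smaller than the least one.\<close>
    moreover have "inj_on (\<lambda>k. \<sigma> (int k)) {..<n}"
    proof (rule linorder_inj_onI)
      fix a b assume ab: "a < b" "a \<in> {..<n}" "b \<in> {..<n}"
      show "\<sigma> (int a) \<noteq> \<sigma> (int b)"
      proof
        assume "\<sigma> (int a) = \<sigma> (int b)"
        then have "n \<le> nat (int b - int a)" using ab by (intro n(2) period) auto
        then show False using ab by auto
      qed
    qed auto
    ultimately have bij: "bij_betw (\<lambda>k. \<sigma> (int k)) {..<n} I" by (simp add: bij_betw_def)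
    have "R = (\<lambda>k. (\<sigma> (int k), \<sigma> (int ((k + 1) mod n)))) ` {..<n}"
    proof -
      have "R = (\<lambda>a. (a, s a)) ` I" by (auto simp: R_iff)
      also have "\<dots> = (\<lambda>k. (\<sigma> (int k), s (\<sigma> (int k)))) ` {..<n}"
        using bij by (auto simp: bij_betw_def image_image)
      also have "\<dots> = (\<lambda>k. (\<sigma> (int k), \<sigma> (int ((k + 1) mod n)))) ` {..<n}"
        by (simp add: zmod_int per_mod step[symmetric] add.commute)
      finally show ?thesis .
    qed
    with bij n0(1) show thesis by (intro finite[of n "\<lambda>k. \<sigma> (int k)"])
  qed
qed

section \<open>Subdirectly irreducible kites\<close>

lemma kite_data_kite1: "kite_data {..<n} {..<n} (\<lambda>j. j) (\<lambda>j. (j + 1) mod n :: nat)"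
proof -
  have "(j + 1) mod n = (if j + 1 = n then 0 else j + 1)" if "j < n" for j
    using that by auto
  then show ?thesis
    by (auto simp: kite_data_def inj_on_def simp del: add_Suc_right One_nat_def split: if_splits)
qed

lemma kite_data_kite5: "kite_data {..<n + 1} {..<n} (\<lambda>j. j) (\<lambda>j. j + 1 :: nat)"
  by (auto simp: kite_data_def inj_on_def)

lemma kite_data_kite2: "kite_data UNIV UNIV (\<lambda>j. j) (\<lambda>j. j + 1 :: int)"
  by (auto simp: kite_data_def inj_on_def)

lemma kite_data_kite3: "kite_data UNIV UNIV (\<lambda>j. j) (\<lambda>j. j + 1 :: nat)"
  by (auto simp: kite_data_def inj_on_def)

lemma kite_data_kite4: "kite_data UNIV UNIV (\<lambda>j. j + 1 :: nat) (\<lambda>j. j)"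
  by (auto simp: kite_data_def inj_on_def)

lemma range_add_one_nat: "0 \<notin> range (\<lambda>j. j + 1 :: nat)"
  by auto

lemma image_add_one_mod: "(\<lambda>j. (j + 1) mod n) ` {..<n} = {..<n :: nat}"
  using kite_data_kite1[of n] by (intro endo_inj_surj) (auto simp: kite_data_def)

text \<open>The two-element kites are placed at \<open>n = 0\<close> of type (1), where both index
  sets are empty.\<close>

lemma kite_isomorphic_kite1_0:
  fixes G :: "'g::lattice_group_add itself" and I :: "'i set" and J :: "'j set"
  assumes data: "kite_data I J lam rho" and triv: "(\<forall>g::'g. g = 0) \<or> I = {}"
  shows "fl_isomorphic (kite G I J lam rho) (kite1 G 0)"
proof -
  \<comment> \<open>The new index sets are empty, so \<open>undefined\<close> is never evaluated as
    an index and the map only remembers the side.\<close>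
  let ?p = "kite_pullback {} {} (\<lambda>_::nat. undefined) (\<lambda>_::nat. undefined)
      :: ('i, 'j, 'g) kite_elem \<Rightarrow> _"
  have "?p \<in> fl_hom (kite G I J lam rho) (kite1 G 0)"
    unfolding kite1_def lessThan_0 using data by (intro kite_pullback_hom) (auto simp: kite_data_def)
  moreover have "?p ` kite_carrier I J = kite_carrier {} {}"
    by (rule kite_pullback_image) auto
  moreover have "isl (?p u) = isl u" for u by (cases u) auto
  then have "inj_on ?p (kite_carrier I J)"
    by (intro inj_onI kite_elem_eqI[OF data triv]) (assumption | metis)+
  ultimately show ?thesis
    by (auto simp: fl_isomorphic_def fl_iso_def bij_betw_def kite1_def)
qed

text \<open>A vertex without predecessor gives types (3) and (5). If all vertices have predecessors
  but some vertex has no successor, reversing the edges gives type (4). Otherwise the graph is a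
  two-sided path or a cycle, types (2) and (1).\<close>

lemma kite_SI_type_exists:
  fixes G :: "'g::lattice_group_add itself" and I :: "'i set" and J :: "'j set"
  assumes data: "kite_data I J lam rho" and SI: "subdirectly_irreducible (kite G I J lam rho)"
  shows "\<exists>t. isomorphic_to_type G (kite G I J lam rho) t"
proof (cases "(\<forall>g::'g. g = 0) \<or> I = {}")
  case True
  then show ?thesis
    using kite_isomorphic_kite1_0[OF data, of G] isomorphic_to_type.simps(1) by blast
next
  case False
  then obtain g :: 'g where g: "g \<noteq> 0" by blast
  define R where "R = (\<lambda>j. (lam j, rho j)) ` J"
  have R: "R \<subseteq> I \<times> I" "single_valued R" "single_valued (R\<inverse>)"
    using data by (auto simp: R_def kite_data_def single_valued_def inj_on_def)
  have conn: "X = I" if "X \<subseteq> I" "X \<noteq> {}" "\<And>a b. (a, b) \<in> R \<Longrightarrow> a \<in> X \<longleftrightarrow> b \<in> X" for X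
    using kite_SI_connected[OF data SI g that(1,2)] that(3) unfolding R_def by blast
  note iso = kite_isomorphicI[OF data, of _ _ _ _ _ G, folded R_def]
  show ?thesis
  proof (cases "I \<subseteq> Range R")
    case False
    then obtain i0 where "i0 \<in> I" "i0 \<notin> Range R" by blast
    from R conn this show ?thesis
    proof (rule single_valued_path_cases)
      fix \<sigma> :: "nat \<Rightarrow> 'i"
      assume "bij_betw \<sigma> UNIV I" "R = (\<lambda>k. (\<sigma> k, \<sigma> (k + 1))) ` UNIV"
      then have "isomorphic_to_type G (kite G I J lam rho) Type3"
        using iso[OF kite_data_kite3] by (simp add: kite3_def)
      then show ?thesis ..
    next
      fix \<sigma> :: "nat \<Rightarrow> 'i" and n
      assume "bij_betw \<sigma> {..<n + 1} I" "R = (\<lambda>k. (\<sigma> k, \<sigma> (k + 1))) ` {..<n}"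
      then have "isomorphic_to_type G (kite G I J lam rho) (Type5 n)"
        using iso[OF kite_data_kite5] by (simp add: kite5_def)
      then show ?thesis ..
    qed
  next
    case Range: True
    show ?thesis
    proof (cases "I \<subseteq> Domain R")
      case False
      then obtain i0 where i0: "i0 \<in> I" "i0 \<notin> Range (R\<inverse>)" by auto
      \<comment> \<open>Reversal turns the vertex without successor into the starting vertex of a
        path.\<close>
      have R': "R\<inverse> \<subseteq> I \<times> I" "single_valued ((R\<inverse>)\<inverse>)" using R by auto
      have conn': "X = I"
        if "X \<subseteq> I" "X \<noteq> {}" "\<And>a b. (a, b) \<in> R\<inverse> \<Longrightarrow> a \<in> X \<longleftrightarrow> b \<in> X" for X
        using conn[OF that(1,2)] that(3) by blast
      from R'(1) R(3) R'(2) conn' i0 show ?thesis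
      proof (rule single_valued_path_cases)
        fix \<sigma> :: "nat \<Rightarrow> 'i"
        assume \<sigma>: "bij_betw \<sigma> UNIV I" "R\<inverse> = (\<lambda>k. (\<sigma> k, \<sigma> (k + 1))) ` UNIV"
        have "R = (R\<inverse>)\<inverse>" by simp
        also have "\<dots> = (\<lambda>k. (\<sigma> (k + 1), \<sigma> k)) ` UNIV" unfolding \<sigma>(2) by auto
        finally have "isomorphic_to_type G (kite G I J lam rho) Type4"
          using iso[OF kite_data_kite4 \<sigma>(1)] by (simp add: kite4_def)
        then show ?thesis ..
      next
        fix \<sigma> :: "nat \<Rightarrow> 'i" and n
        assume \<sigma>: "bij_betw \<sigma> {..<n + 1} I" "R\<inverse> = (\<lambda>k. (\<sigma> k, \<sigma> (k + 1))) ` {..<n}"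
        \<comment> \<open>A finite path cannot occur here: its last vertex has no outgoing edge in
          the reversed graph, whereas every vertex has a predecessor in \<open>R\<close>.\<close>
        have "\<sigma> n \<in> Domain (R\<inverse>)" using \<sigma>(1) Range by (auto simp: bij_betw_def)
        then obtain k where "k < n" "\<sigma> n = \<sigma> k" unfolding \<sigma>(2) by auto
        then have "n = k" using \<sigma>(1) by (intro inj_onD[of \<sigma> "{..<n + 1}"]) (auto simp: bij_betw_def)
        then show ?thesis using \<open>k < n\<close> by simp
      qed
    next
      case True
      have DR: "Domain R = I" "Range R = I" using True Range R(1) by auto
      obtain i0 where "i0 \<in> I" using \<open>\<not> (_ \<or> I = {})\<close> by blast
      from R(2,3) DR conn this show ?thesis
      proof (rule single_valued_cycle_cases)
        fix \<sigma> :: "int \<Rightarrow> 'i"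
        assume "bij_betw \<sigma> UNIV I" "R = (\<lambda>k. (\<sigma> k, \<sigma> (k + 1))) ` UNIV"
        then have "isomorphic_to_type G (kite G I J lam rho) Type2"
          using iso[OF kite_data_kite2] by (simp add: kite2_def)
        then show ?thesis ..
      next
        fix \<sigma> :: "nat \<Rightarrow> 'i" and n
        assume "bij_betw \<sigma> {..<n} I" "R = (\<lambda>k. (\<sigma> k, \<sigma> ((k + 1) mod n))) ` {..<n}"
        then have "isomorphic_to_type G (kite G I J lam rho) (Type1 n)"
          unfolding isomorphic_to_type.simps kite1_def by (rule iso[OF kite_data_kite1])
        then show ?thesis ..
      qed
    qed
  qed
qed

section \<open>Invariants separating the types\<close>

definition lneg_faithful :: "'a fl_sig \<Rightarrow> bool" where
  "lneg_faithful A \<longleftrightarrow> (\<forall>x\<in>carrier A. lneg A x = fl_zero A \<longrightarrow> x = \<one>\<^bsub>A\<^esub>)"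

definition rneg_faithful :: "'a fl_sig \<Rightarrow> bool" where
  "rneg_faithful A \<longleftrightarrow> (\<forall>x\<in>carrier A. rneg A x = fl_zero A \<longrightarrow> x = \<one>\<^bsub>A\<^esub>)"

definition lneg_even :: "'a fl_sig \<Rightarrow> nat \<Rightarrow> 'a \<Rightarrow> 'a" where
  "lneg_even A k = (lneg A \<circ> lneg A) ^^ k"

text \<open>In a kite, the condition $x x \neq 0$ singles out the elements of $(G^-)^I$.\<close>

definition lneg_periodic :: "'a fl_sig \<Rightarrow> nat \<Rightarrow> bool" where
  "lneg_periodic A k \<longleftrightarrow>
     (\<forall>x\<in>carrier A. x \<otimes>\<^bsub>A\<^esub> x \<noteq> fl_zero A \<longrightarrow> lneg_even A k x = x)"

text \<open>Exponent 0 is meaningful: for a kite over a nontrivial group it says that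
  \<open>I\<close> is empty, which singles out \<open>n = 0\<close> in type (1).\<close>

definition lneg_nilpotent :: "'a fl_sig \<Rightarrow> nat \<Rightarrow> bool" where
  "lneg_nilpotent A k \<longleftrightarrow>
     (\<forall>x\<in>carrier A. x \<otimes>\<^bsub>A\<^esub> x \<noteq> fl_zero A \<longrightarrow> lneg_even A k x = \<one>\<^bsub>A\<^esub>)"

lemma fl_isomorphic_invariants:
  assumes "fl_algebra A" and "fl_isomorphic A B"
  shows "lneg_faithful A \<longleftrightarrow> lneg_faithful B" "rneg_faithful A \<longleftrightarrow> rneg_faithful B"
    and "lneg_periodic A k \<longleftrightarrow> lneg_periodic B k" "lneg_nilpotent A k \<longleftrightarrow> lneg_nilpotent B k"
proof -
  interpret fl_algebra A by fact
  obtain h where hom: "h \<in> fl_hom A B" and bij: "bij_betw h (carrier A) (carrier B)"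
    using assms(2) by (auto simp: fl_isomorphic_def fl_iso_def)
  have one: "\<one>\<^bsub>B\<^esub> = h \<one>\<^bsub>A\<^esub>" and zero: "fl_zero B = h (fl_zero A)"
    using hom by (auto simp: fl_hom_def)
  have mult: "h x \<otimes>\<^bsub>B\<^esub> h x = h (x \<otimes>\<^bsub>A\<^esub> x)" and lneg: "lneg B (h x) = h (lneg A x)"
    and rneg: "rneg B (h x) = h (rneg A x)" if "x \<in> carrier A" for x
    using hom that zero_closed by (auto simp: fl_hom_def lneg_def rneg_def)
  have cl: "lneg A x \<in> carrier A" "rneg A x \<in> carrier A" if "x \<in> carrier A" for x
    using that by (auto simp: lneg_def rneg_def ldiv_closed rdiv_closed zero_closed)
  have even: "lneg_even A k x \<in> carrier A \<and> lneg_even B k (h x) = h (lneg_even A k x)"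
    if "x \<in> carrier A" for x
    using that by (induction k) (auto simp: lneg_even_def cl lneg)
  have inj: "h x = h y \<longleftrightarrow> x = y" if "x \<in> carrier A" "y \<in> carrier A" for x y
    using bij that by (auto simp: bij_betw_def inj_on_def)
  have B: "carrier B = h ` carrier A" using bij by (simp add: bij_betw_def)
  note simps = B one zero mult lneg rneg cl even inj zero_closed
  show "lneg_faithful A \<longleftrightarrow> lneg_faithful B" "rneg_faithful A \<longleftrightarrow> rneg_faithful B"
    "lneg_periodic A k \<longleftrightarrow> lneg_periodic B k" "lneg_nilpotent A k \<longleftrightarrow> lneg_nilpotent B k"
    by (simp_all add: lneg_faithful_def rneg_faithful_def lneg_periodic_def lneg_nilpotent_def
        simps cong: ball_cong)
qed

section \<open>The invariants of a kite expressed by its graph\<close>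

definition kite_edges :: "'j set \<Rightarrow> ('j \<Rightarrow> 'i) \<Rightarrow> ('j \<Rightarrow> 'i) \<Rightarrow> ('i \<times> 'i) set" where
  "kite_edges J lam rho = (\<lambda>j. (lam j, rho j)) ` J"

context
  fixes G :: "'g::lattice_group_add itself" and I :: "'i set" and J :: "'j set" and lam rho
    and h :: 'g
  assumes data: "kite_data I J lam rho" and h: "h \<le> 0" "h \<noteq> 0"
begin

private lemma lam_mem: "j \<in> J \<Longrightarrow> lam j \<in> I"
  using data by (auto simp: kite_data_def)

private lemma rho_mem: "j \<in> J \<Longrightarrow> rho j \<in> I" "j \<in> J \<Longrightarrow> the_inv_into J rho (rho j) = j"
  using data by (auto simp: kite_data_def the_inv_into_f_f)

lemma kite_faithful_iff:
  "lneg_faithful (kite G I J lam rho) \<longleftrightarrow> lam ` J = I"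
  "rneg_faithful (kite G I J lam rho) \<longleftrightarrow> rho ` J = I"
proof -
  \<comment> \<open>One claim for both negations: \<open>N\<close> reads the coordinates of (G^-)^I
    through \<open>m\<close>. A sequence supported at a vertex outside the image of \<open>m\<close>
    is invisible to \<open>N\<close>, so it is sent to 0 without being 1.\<close>
  have *: "(\<forall>u\<in>kite_carrier I J. N u = Inl (\<lambda>j\<in>J. 0) \<longrightarrow> u = Inr (\<lambda>i\<in>I. 0)) \<longleftrightarrow> m ` J = I"
    if Inl: "\<And>f. (\<And>j. j \<in> J \<Longrightarrow> 0 \<le> f j) \<Longrightarrow> \<not> isl (N (Inl f))"
      and Inr: "\<And>x. N (Inr x) = Inl (\<lambda>j\<in>J. - x (m j))" and m: "\<And>j. j \<in> J \<Longrightarrow> m j \<in> I"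
    for N :: "('i, 'j, 'g) kite_elem \<Rightarrow> ('i, 'j, 'g) kite_elem" and m
  proof
    assume L: "\<forall>u\<in>kite_carrier I J. N u = Inl (\<lambda>j\<in>J. 0) \<longrightarrow> u = Inr (\<lambda>i\<in>I. 0)"
    have "i \<in> m ` J" if "i \<in> I" for i
    proof (rule ccontr)
      assume "i \<notin> m ` J"
      then have "N (Inr (\<lambda>a\<in>I. if a = i then h else 0)) = Inl (\<lambda>j\<in>J. 0)"
        using m by (auto simp: Inr restrict_eq_iff)
      then have "Inr (\<lambda>a\<in>I. if a = i then h else 0) =
          (Inr (\<lambda>a\<in>I. 0) :: ('i, 'j, 'g) kite_elem)"
        using h by (intro L[rule_format]) auto
      then show False using h that by (auto simp: restrict_eq_iff)
    qed
    then show "m ` J = I" using m by blast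
  next
    assume onto: "m ` J = I"
    show "\<forall>u\<in>kite_carrier I J. N u = Inl (\<lambda>j\<in>J. 0) \<longrightarrow> u = Inr (\<lambda>i\<in>I. 0)"
    proof (intro ballI impI)
      fix u :: "('i, 'j, 'g) kite_elem"
      assume "u \<in> kite_carrier I J" and N: "N u = Inl (\<lambda>j\<in>J. 0)"
      then show "u = Inr (\<lambda>i\<in>I. 0)"
      proof (cases rule: kite_carrierE)
        case (1 f)
        then show ?thesis using Inl[of f] N by simp
      next
        case (2 x)
        then have "x (m j) = 0" if "j \<in> J" for j
          using N that by (auto simp: Inr restrict_eq_iff)
        then show ?thesis using 2 onto by (auto simp: restrict_eq_extensional_iff)
      qed
    qed
  qed
  have "\<not> isl (lneg (kite G I J lam rho) (Inl f))" "\<not> isl (rneg (kite G I J lam rho) (Inl f))" for f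
    by (simp_all add: lneg_def rneg_def)
  then show "lneg_faithful (kite G I J lam rho) \<longleftrightarrow> lam ` J = I"
    "rneg_faithful (kite G I J lam rho) \<longleftrightarrow> rho ` J = I"
    unfolding lneg_faithful_def rneg_faithful_def kite_sel
    by (intro *; simp add: lneg_Inr[OF data] rneg_Inr[OF data] lam_mem rho_mem(1))+
qed

text \<open>One double negation moves the coordinate at \<open>lam j\<close> to \<open>rho j\<close>
  and puts 0 where no edge ends, so \<open>k\<close> of them act along walks of length
  \<open>k\<close>. The sign of \<open>y\<close> keeps the induction going.\<close>

lemma lneg_even_Inr:
  assumes "x \<in> extensional I" "\<And>i. i \<in> I \<Longrightarrow> x i \<le> 0"
  shows "\<exists>y. lneg_even (kite G I J lam rho) k (Inr x) = Inr y \<and> y \<in> extensional I \<and>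
    (\<forall>i\<in>I. y i \<le> 0) \<and>
    (\<forall>a\<in>I. \<forall>b\<in>I. (a, b) \<in> kite_edges J lam rho ^^ k \<longrightarrow> y b = x a) \<and>
    (\<forall>b\<in>I. (\<forall>a\<in>I. (a, b) \<notin> kite_edges J lam rho ^^ k) \<longrightarrow> y b = 0)"
proof (induction k)
  case 0
  show ?case by (rule exI[of _ x]) (use assms in \<open>auto simp: lneg_even_def\<close>)
next
  case (Suc k)
  then obtain y where y: "lneg_even (kite G I J lam rho) k (Inr x) = Inr y"
    "\<And>i. i \<in> I \<Longrightarrow> y i \<le> 0"
    "\<And>a b. a \<in> I \<Longrightarrow> b \<in> I \<Longrightarrow> (a, b) \<in> kite_edges J lam rho ^^ k \<Longrightarrow> y b = x a"
    "\<And>b. b \<in> I \<Longrightarrow> \<forall>a\<in>I. (a, b) \<notin> kite_edges J lam rho ^^ k \<Longrightarrow> y b = 0"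
    by blast
  define z where "z = (\<lambda>i\<in>I. if i \<in> rho ` J then y (lam (the_inv_into J rho i)) else 0)"
  have z_rho: "z (rho j) = y (lam j)" if "j \<in> J" for j
    using that rho_mem by (simp add: z_def)
  have "lneg_even (kite G I J lam rho) (Suc k) (Inr x) =
      lneg (kite G I J lam rho) (lneg (kite G I J lam rho) (Inr y))"
    using y(1) by (simp add: lneg_even_def)
  also have "\<dots> = Inr z"
    using y(2) lam_mem rho_mem
    by (auto simp: lneg_Inr[OF data] lneg_Inl[OF data] z_def restrict_eq_iff lg_neg_nonneg_iff)
  finally have "lneg_even (kite G I J lam rho) (Suc k) (Inr x) = Inr z" .
  moreover have "z \<in> extensional I" by (simp add: z_def)
  moreover have "z i \<le> 0" if "i \<in> I" for i
    using that y(2) lam_mem rho_mem by (auto simp: z_def)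
  moreover have "z b = x a"
    if ab: "a \<in> I" "b \<in> I" "(a, b) \<in> kite_edges J lam rho ^^ Suc k" for a b
  proof -
    obtain j where "j \<in> J" "(a, lam j) \<in> kite_edges J lam rho ^^ k" "b = rho j"
      using ab(3) by (auto simp: kite_edges_def)
    then show ?thesis using y(3) ab(1) lam_mem z_rho by simp
  qed
  moreover have "z b = 0"
    if b: "b \<in> I" "\<forall>a\<in>I. (a, b) \<notin> kite_edges J lam rho ^^ Suc k" for b
  proof (cases "b \<in> rho ` J")
    case True
    then obtain j where j: "j \<in> J" "b = rho j" by blast
    then have "(lam j, b) \<in> kite_edges J lam rho" by (simp add: kite_edges_def)
    then have "y (lam j) = 0" using y(4)[of "lam j"] b(2) lam_mem[OF j(1)] by (meson relpow_Suc_I)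
    then show ?thesis using z_rho j by simp
  qed (use b(1) in \<open>simp add: z_def\<close>)
  ultimately show ?case by blast
qed

text \<open>A sequence supported at a single vertex \<open>i\<close> can only return to itself if a
  walk of length \<open>k\<close> ends at \<open>i\<close> and starts in the support, that is, at
  \<open>i\<close>.\<close>

lemma kite_periodic_iff:
  "lneg_periodic (kite G I J lam rho) k \<longleftrightarrow> (\<forall>i\<in>I. (i, i) \<in> kite_edges J lam rho ^^ k)"
proof
  assume per: "lneg_periodic (kite G I J lam rho) k"
  show "\<forall>i\<in>I. (i, i) \<in> kite_edges J lam rho ^^ k"
  proof (rule ballI, rule ccontr)
    fix i assume i: "i \<in> I" "(i, i) \<notin> kite_edges J lam rho ^^ k"
    let ?x = "\<lambda>a\<in>I. if a = i then h else 0"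
    have x: "?x \<in> extensional I" "\<And>a. a \<in> I \<Longrightarrow> ?x a \<le> 0" using h by auto
    obtain y where y: "lneg_even (kite G I J lam rho) k (Inr ?x) = Inr y"
      "\<And>a b. a \<in> I \<Longrightarrow> b \<in> I \<Longrightarrow> (a, b) \<in> kite_edges J lam rho ^^ k \<Longrightarrow> y b = ?x a"
      "\<And>b. b \<in> I \<Longrightarrow> \<forall>a\<in>I. (a, b) \<notin> kite_edges J lam rho ^^ k \<Longrightarrow> y b = 0"
      using lneg_even_Inr[OF x, of k] by blast
    have "lneg_even (kite G I J lam rho) k (Inr ?x) = Inr ?x"
      using per h by (simp add: lneg_periodic_def)
    then have "y i = h" using y(1) i by simp
    then obtain a where "a \<in> I" "(a, i) \<in> kite_edges J lam rho ^^ k"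
      using y(3)[of i] i(1) h(2) by auto
    then show False using y(2)[of a i] \<open>y i = h\<close> i h(2) by (auto split: if_splits)
  qed
next
  assume loops: "\<forall>i\<in>I. (i, i) \<in> kite_edges J lam rho ^^ k"
  show "lneg_periodic (kite G I J lam rho) k"
    unfolding lneg_periodic_def kite_sel
  proof (intro ballI impI)
    fix u :: "('i, 'j, 'g) kite_elem"
    assume "u \<in> kite_carrier I J" "kite_mult I J lam rho u u \<noteq> Inl (\<lambda>j\<in>J. 0)"
    then obtain x where u: "u = Inr x" "x \<in> extensional I" "\<And>i. i \<in> I \<Longrightarrow> x i \<le> 0"
      by (auto elim!: kite_carrierE)
    obtain y where "lneg_even (kite G I J lam rho) k (Inr x) = Inr y" "y \<in> extensional I"
      "\<And>a b. a \<in> I \<Longrightarrow> b \<in> I \<Longrightarrow> (a, b) \<in> kite_edges J lam rho ^^ k \<Longrightarrow> y b = x a"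
      using lneg_even_Inr[OF u(2,3), of k] by blast
    then show "lneg_even (kite G I J lam rho) k u = u"
      using loops u by (auto intro!: extensionalityI[of _ I])
  qed
qed

text \<open>The constant sequence \<open>h\<close> survives at every vertex where a walk of length
  \<open>k\<close> ends.\<close>

lemma kite_nilpotent_iff:
  "lneg_nilpotent (kite G I J lam rho) k \<longleftrightarrow>
     (\<forall>a\<in>I. \<forall>b\<in>I. (a, b) \<notin> kite_edges J lam rho ^^ k)"
proof
  assume nil: "lneg_nilpotent (kite G I J lam rho) k"
  let ?x = "\<lambda>a\<in>I. h"
  have x: "?x \<in> extensional I" "\<And>a. a \<in> I \<Longrightarrow> ?x a \<le> 0" using h by auto
  obtain y where y: "lneg_even (kite G I J lam rho) k (Inr ?x) = Inr y"
    "\<And>a b. a \<in> I \<Longrightarrow> b \<in> I \<Longrightarrow> (a, b) \<in> kite_edges J lam rho ^^ k \<Longrightarrow> y b = ?x a"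
    using lneg_even_Inr[OF x, of k] by blast
  have "lneg_even (kite G I J lam rho) k (Inr ?x) = Inr (\<lambda>i\<in>I. 0)"
    using nil h by (simp add: lneg_nilpotent_def)
  then show "\<forall>a\<in>I. \<forall>b\<in>I. (a, b) \<notin> kite_edges J lam rho ^^ k"
    using y h(2) by auto
next
  assume none: "\<forall>a\<in>I. \<forall>b\<in>I. (a, b) \<notin> kite_edges J lam rho ^^ k"
  show "lneg_nilpotent (kite G I J lam rho) k"
    unfolding lneg_nilpotent_def kite_sel
  proof (intro ballI impI)
    fix u :: "('i, 'j, 'g) kite_elem"
    assume "u \<in> kite_carrier I J" "kite_mult I J lam rho u u \<noteq> Inl (\<lambda>j\<in>J. 0)"
    then obtain x where u: "u = Inr x" "x \<in> extensional I" "\<And>i. i \<in> I \<Longrightarrow> x i \<le> 0"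
      by (auto elim!: kite_carrierE)
    obtain y where "lneg_even (kite G I J lam rho) k (Inr x) = Inr y" "y \<in> extensional I"
      "\<And>b. b \<in> I \<Longrightarrow> \<forall>a\<in>I. (a, b) \<notin> kite_edges J lam rho ^^ k \<Longrightarrow> y b = 0"
      using lneg_even_Inr[OF u(2,3), of k] by blast
    then show "lneg_even (kite G I J lam rho) k u = Inr (\<lambda>i\<in>I. 0)"
      using none u by (auto simp: restrict_eq_extensional_iff)
  qed
qed

end

section \<open>Walks in the graphs of the list\<close>

lemma relpow_Suc_iff: "(a, b) \<in> R ^^ Suc k \<longleftrightarrow> (\<exists>c. (a, c) \<in> R ^^ k \<and> (c, b) \<in> R)"
  by auto

lemma kite_edges_relpow_kite1:
  assumes "a < n"
  shows "(a, b) \<in> kite_edges {..<n} (\<lambda>j. j) (\<lambda>j. (j + 1) mod n) ^^ k \<longleftrightarrow> b = (a + k) mod n"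
proof (induction k arbitrary: b)
  case (Suc k)
  have "(a + k) mod n < n" using assms by simp
  then show ?case
    unfolding relpow_Suc_iff Suc unfolding kite_edges_def by (auto simp: mod_Suc_eq)
qed (use assms in auto)

lemma kite_edges_relpow_kite2:
  "(a, b) \<in> kite_edges UNIV (\<lambda>j. j) (\<lambda>j. j + 1 :: int) ^^ k \<longleftrightarrow> b = a + int k"
proof (induction k arbitrary: b)
  case (Suc k)
  show ?case unfolding relpow_Suc_iff Suc unfolding kite_edges_def by auto
qed auto

lemma kite_edges_relpow_kite5:
  assumes "a \<le> n"
  shows "(a, b) \<in> kite_edges {..<n} (\<lambda>j. j) (\<lambda>j. j + 1 :: nat) ^^ k \<longleftrightarrow>
    b = a + k \<and> b \<le> n"
proof (induction k arbitrary: b)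
  case (Suc k)
  show ?case unfolding relpow_Suc_iff Suc unfolding kite_edges_def by auto
qed (use assms in auto)

text \<open>Faithfulness of the two negations separates types (3), (4) and (5) from each other and
  from (1) and (2). In types (1) and (2) the periods decide, and in type (5) the nilpotency index.
  For \<open>n = 0\<close> in type (1) every \<open>k\<close> is vacuously a period, hence the extra
  test with exponent 0.\<close>

lemma isomorphic_to_type_invariants:
  fixes G :: "'g::lattice_group_add itself" and g :: 'g
  assumes A: "fl_algebra A" and g: "g \<noteq> 0" and t: "isomorphic_to_type G A t"
  shows "case t of
      Type1 n \<Rightarrow> lneg_faithful A \<and> rneg_faithful A \<and> (lneg_nilpotent A 0 \<longleftrightarrow> n = 0) \<and>
        (n > 0 \<longrightarrow> lneg_periodic A n \<and> (\<forall>k. lneg_periodic A k \<longrightarrow> n dvd k))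
    | Type2 \<Rightarrow> lneg_faithful A \<and> rneg_faithful A \<and> \<not> lneg_nilpotent A 0 \<and>
        (\<forall>k. lneg_periodic A k \<longrightarrow> k = 0)
    | Type3 \<Rightarrow> lneg_faithful A \<and> \<not> rneg_faithful A
    | Type4 \<Rightarrow> \<not> lneg_faithful A \<and> rneg_faithful A
    | Type5 n \<Rightarrow> \<not> lneg_faithful A \<and> \<not> rneg_faithful A \<and>
        lneg_nilpotent A (Suc n) \<and> (\<forall>k. lneg_nilpotent A k \<longrightarrow> n < k)"
proof -
  obtain h :: 'g where h: "h \<le> 0" "h \<noteq> 0" using g by (rule lg_negative_exists)
  note inv = fl_isomorphic_invariants[OF A]
  note kite_iff = kite_faithful_iff[OF _ h] kite_periodic_iff[OF _ h] kite_nilpotent_iff[OF _ h]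
  show ?thesis
  proof (cases t)
    case (Type1 n)
    \<comment> \<open>Returning to vertex 0 alone already forces divisibility.\<close>
    have "n dvd k" if "n > 0" "\<forall>i\<in>{..<n}. i = (i + k) mod n" for k
      using bspec[OF that(2), of 0] that(1) by (simp add: dvd_eq_mod_eq_0)
    moreover from t Type1 have iso: "fl_isomorphic A (kite1 G n)" by simp
    ultimately show ?thesis
      unfolding Type1 kite_type.case inv[OF iso] kite1_def kite_iff[OF kite_data_kite1]
        image_add_one_mod
      by (auto simp: kite_edges_relpow_kite1 simp del: One_nat_def add_Suc_right)
  next
    case Type2
    then have iso: "fl_isomorphic A (kite2 G)" using t by simp
    show ?thesis
      unfolding Type2 kite_type.case inv[OF iso] kite2_def
        kite_iff[OF kite_data_kite2] kite_edges_relpow_kite2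
      using surjI[of "\<lambda>j. j + 1" "\<lambda>j :: int. j - 1"] by auto
  next
    case Type3
    then have iso: "fl_isomorphic A (kite3 G)" using t by simp
    show ?thesis
      unfolding Type3 kite_type.case inv[OF iso] kite3_def
        kite_iff[OF kite_data_kite3] 
      using range_add_one_nat by auto
  next
    case Type4
    then have iso: "fl_isomorphic A (kite4 G)" using t by simp
    show ?thesis
      unfolding Type4 kite_type.case inv[OF iso] kite4_def
        kite_iff[OF kite_data_kite4] 
      using range_add_one_nat by auto
  next
    case (Type5 n)
    have onto: "{..<n} \<noteq> {..<n + 1}" "(\<lambda>j. j + 1) ` {..<n} \<noteq> {..<n + 1}"
      by (auto simp: set_eq_iff image_iff intro: exI[of _ "0::nat"])
    \<comment> \<open>The longest walk leads from 0 to \<open>n\<close> and has length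
      \<open>n\<close>.\<close>
    have nil: "(\<forall>a\<in>{..<n + 1}. \<forall>b\<in>{..<n + 1}.
        (a, b) \<notin> kite_edges {..<n} (\<lambda>j. j) (\<lambda>j. j + 1) ^^ k) \<longleftrightarrow> n < k" for k
    proof -
      have "(a, b) \<in> kite_edges {..<n} (\<lambda>j. j) (\<lambda>j. j + 1) ^^ k \<longleftrightarrow> b = a + k"
        if "a \<in> {..<n + 1}" "b \<in> {..<n + 1}" for a b
        using that by (subst kite_edges_relpow_kite5) auto
      then have "(\<forall>a\<in>{..<n + 1}. \<forall>b\<in>{..<n + 1}.
          (a, b) \<notin> kite_edges {..<n} (\<lambda>j. j) (\<lambda>j. j + 1) ^^ k) \<longleftrightarrow>
        (\<forall>a\<in>{..<n + 1}. \<forall>b\<in>{..<n + 1}. b \<noteq> a + k)"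
        by blast
      also have "\<dots> \<longleftrightarrow> n < k" by (cases "n < k") (auto intro!: bexI[of _ 0])
      finally show ?thesis .
    qed
    from t Type5 have iso: "fl_isomorphic A (kite5 G n)" by simp
    show ?thesis
      unfolding Type5 kite_type.case inv[OF iso] kite5_def kite_iff[OF kite_data_kite5] nil
      using onto by simp
  qed
qed

lemma isomorphic_to_type_unique:
  fixes G :: "'g::lattice_group_add itself" and g :: 'g
  assumes "fl_algebra A" "g \<noteq> 0" "isomorphic_to_type G A s" "isomorphic_to_type G A t"
  shows "s = t"
proof -
  note inv = isomorphic_to_type_invariants[OF assms(1,2)]
  \<comment> \<open>The least nilpotency exponent is one more than the parameter of type (5), so it
    determines the parameter. For type (1), the cycle lengths divide each other.\<close>
  have "m = n" if "\<forall>k. lneg_nilpotent A k \<longrightarrow> m < k" "lneg_nilpotent A (Suc n)"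
    "\<forall>k. lneg_nilpotent A k \<longrightarrow> n < k" "lneg_nilpotent A (Suc m)" for m n
    using that by (metis less_Suc_eq less_asym)
  then show ?thesis
    using inv[OF assms(3)] inv[OF assms(4)]
    by (cases s; cases t) (auto intro: dvd_antisym)
qed

text \<open>Over the trivial group every kite has two elements, so all types coincide and every kite
  is good. Uniqueness of the type and the converse about goodness in type (5) are therefore claimed
  for nontrivial groups.\<close>

theorem theorem5p9:
  fixes G :: "'g::lattice_group_add itself"
  shows "(\<forall>(I :: 'i set) (J :: 'j set) lam rho.
            kite_data I J lam rho \<and> subdirectly_irreducible (kite G I J lam rho) \<longrightarrow>
              (\<exists>t. isomorphic_to_type G (kite G I J lam rho) t) \<and>
              ((\<exists>g::'g. g \<noteq> 0) \<longrightarrow> (\<exists>!t. isomorphic_to_type G (kite G I J lam rho) t)))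
       \<and> (\<forall>n. pseudo_mv (kite1 G n))
       \<and> pseudo_mv (kite2 G)
       \<and> (pseudo_mv (kite3 G) \<longleftrightarrow> fl_isomorphic (kite3 G) bool_fl)
       \<and> (pseudo_mv (kite4 G) \<longleftrightarrow> fl_isomorphic (kite4 G) bool_fl)
       \<and> (\<forall>n. pseudo_mv (kite5 G n) \<longleftrightarrow> fl_isomorphic (kite5 G n) bool_fl)
       \<and> (good_pseudo_bl (kite3 G) \<longleftrightarrow> fl_isomorphic (kite3 G) bool_fl)
       \<and> (good_pseudo_bl (kite4 G) \<longleftrightarrow> fl_isomorphic (kite4 G) bool_fl)
       \<and> (\<forall>n. {..<n} = {} \<longrightarrow> good_pseudo_bl (kite5 G n))
       \<and> ((\<exists>g::'g. g \<noteq> 0) \<longrightarrow> (\<forall>n. good_pseudo_bl (kite5 G n) \<longleftrightarrow> {..<n} = {}))"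
proof -
  have SI: "(\<exists>t. isomorphic_to_type G (kite G I J lam rho) t) \<and>
      ((\<exists>g::'g. g \<noteq> 0) \<longrightarrow> (\<exists>!t. isomorphic_to_type G (kite G I J lam rho) t))"
    if "kite_data I J lam rho" "subdirectly_irreducible (kite G I J lam rho)"
    for I :: "'i set" and J :: "'j set" and lam rho
    using kite_SI_type_exists[OF that] isomorphic_to_type_unique[OF kite_fl_algebra[OF that(1)]]
    by blast
  \<comment> \<open>In type (5) \<open>lam\<close> misses the last vertex \<open>n\<close> and
    \<open>rho\<close> misses 0, so the images agree only when there are no edges. As
    \<open>I\<close> is nonempty, the pseudo MV and Boolean criteria both reduce to triviality of
    the group.\<close>
  have path: "(\<lambda>j. j) ` {..<n} \<noteq> {..<n + 1}" "(\<lambda>j. j) ` {..<n} = (\<lambda>j. j + 1) ` {..<n} \<longleftrightarrow> n = 0"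
    "{..<n + 1} \<noteq> {}" for n :: nat
    by (auto simp: set_eq_iff image_iff intro: exI[of _ "0::nat"])
  have int: "range (\<lambda>j::int. j + 1) = UNIV"
    by (rule surjI[of _ "\<lambda>j. j - 1"]) simp
  \<comment> \<open>In types (3) and (4) exactly one of the two maps misses 0, so all three criteria
    reduce to triviality of the group.\<close>
  have nat: "range (\<lambda>j. j + 1 :: nat) \<noteq> UNIV" "range (\<lambda>j::nat. j) \<noteq> range (\<lambda>j. j + 1)"
    "range (\<lambda>j. j + 1) \<noteq> range (\<lambda>j::nat. j)"
    using range_add_one_nat by (metis UNIV_I, metis rangeI, metis rangeI)
  note iffs = kite_pseudo_mv_iff kite_good_iff kite_isomorphic_bool_iff
  show ?thesis
  proof (intro conjI allI impI)
    fix n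
    show "pseudo_mv (kite1 G n)"
      unfolding kite1_def iffs[OF kite_data_kite1] image_add_one_mod by simp
    show "pseudo_mv (kite5 G n) \<longleftrightarrow> fl_isomorphic (kite5 G n) bool_fl"
      unfolding kite5_def iffs[OF kite_data_kite5] using path[of n] by blast
    show "good_pseudo_bl (kite5 G n)" if "{..<n} = {}"
      unfolding kite5_def iffs[OF kite_data_kite5] path(2) using that by auto
    show "good_pseudo_bl (kite5 G n) \<longleftrightarrow> {..<n} = {}" if "\<exists>g::'g. g \<noteq> 0"
      unfolding kite5_def iffs[OF kite_data_kite5] path(2) using that by auto
  next
    show "pseudo_mv (kite2 G)"
      unfolding kite2_def iffs[OF kite_data_kite2] int by simp
    show "pseudo_mv (kite3 G) \<longleftrightarrow> fl_isomorphic (kite3 G) bool_fl"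
      "good_pseudo_bl (kite3 G) \<longleftrightarrow> fl_isomorphic (kite3 G) bool_fl"
      unfolding kite3_def iffs[OF kite_data_kite3] using nat by blast+
    show "pseudo_mv (kite4 G) \<longleftrightarrow> fl_isomorphic (kite4 G) bool_fl"
      "good_pseudo_bl (kite4 G) \<longleftrightarrow> fl_isomorphic (kite4 G) bool_fl"
      unfolding kite4_def iffs[OF kite_data_kite4] using nat by blast+
  qed (use SI in blast)+
qed


end
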